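(* Let $n\in\mathbb{N}$, let $\mathcal{P}$ be a finite prototile set in $\mathbb{R}^n$, let $g:\coprod_{P\in\mathcal{P}}P\to C$ be a colouring and let $r$ be a facet matching rule on $C$. Then every $(\mathcal{P},G_{Tr},g,r)$-tiling $T$ is MLD (mutually locally derivable) to some $(\mathcal{X},G_{I},\mathcal{U})$-tiling, where $\mathcal{X}$ is a prototile set with $|\mathcal{X}|\le|\mathcal{P}|$ and $\mathcal{U}$ is a $1$-corona atlas rule.
   Context: A prototile set $\mathcal{P}$ is a finite set of compact subsets of $\mathbb{R}^n$, each the closure of its interior. $G_{Tr}$ denotes the group of all translations of $\mathbb{R}^n$ and $G_I$ the group of all isometries of $\mathbb{R}^n$. For a group $G$ of isometries containing all translations, a tile is a set $f(P)$ with $f\in G$, $P\in\mathcal{P}$; a patch is a set of tiles with pairwise disjoint interiors; a tiling is a patch whose union is $\mathbb{R}^n$. A colouring is a function $g:\coprod_{P\in\mathcal{P}}P\to C$, where $C$ is a set containing a distinguished element $0$; it is extended to a tile $t=f(P)$ by $g_t(x)=g(f^{-1}(x))$ for $x\in t$. A facet matching rule is a function $r:C\times C\to\{0,1\}$ with $r(x,y)=r(y,x)$ and $r(0,0)=1$; a coloured tiling satisfies $r$ if for all distinct tiles $t_1,t_2$ one has $r(g_{t_1}(x),g_{t_2}(x))=1$ for all $x\in t_1\cap t_2$. A $(\mathcal{P},G,g,r)$-tiling is a tiling with prototile set $\mathcal{P}$, allowable isometries $G$ and colouring $g$ satisfying the facet rule $r$. An atlas matching rule is a finite set $\mathcal{U}$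 of patches with compact support; a tiling $T$ satisfies $\mathcal{U}$ if for every tile $t\in T$ there is a patch $n(t)\subseteq T$ containing $t$ in its strict interior which is a translate of some element of $\mathcal{U}$. The $1$-corona of a tile $t$ is the set of tiles touching $t$; a $1$-corona atlas rule is one whose patches are tiles together with their $1$-coronas (with the patch $n(t)$ being the 1-corona patch of $t$). A $(\mathcal{X},G,\mathcal{U})$-tiling is a tiling with prototile set $\mathcal{X}$ and allowable isometries $G$ satisfying the atlas rule $\mathcal{U}$. Two tilings are MLD if each is obtained from the other in a unique way by local rules.
   Formalization: The formal theorem assumes T has finite local complexity (finitely many patches of each radius up to translation); without it the claim fails, e.g. unit-square columns with infinitely many relative shifts, and being MLD to a tiling with a finite atlas forces it. *)

theory Defs
  imports "HOL-Analysis.Analysis"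
begin

type_synonym 'n space = "real ^ 'n"

definition translation_group :: "('n::finite space \<Rightarrow> 'n space) set" where
  "translation_group = range (+)"

definition isometry_group :: "('n::finite space \<Rightarrow> 'n space) set" where
  "isometry_group = {f. surj f \<and> (\<forall>x y. dist (f x) (f y) = dist x y)}"

definition prototile_set :: "'n::finite space set set \<Rightarrow> bool" where
  "prototile_set \<P> \<longleftrightarrow> finite \<P> \<and> (\<forall>P\<in>\<P>. compact P \<and> closure (interior P) = P)"

definition tiles :: "'n::finite space set set \<Rightarrow> ('n space \<Rightarrow> 'n space) set \<Rightarrow> 'n space set set" where
  "tiles \<P> G = {f ` P |f P. f \<in> G \<and> P \<in> \<P>}"

definition patch :: "'n::finite space set set \<Rightarrow> ('n space \<Rightarrow> 'n space) set \<Rightarrow> 'n space set set \<Rightarrow> bool" where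
  "patch \<P> G A \<longleftrightarrow> A \<subseteq> tiles \<P> G \<and> pairwise (\<lambda>s t. interior s \<inter> interior t = {}) A"

definition tiling :: "'n::finite space set set \<Rightarrow> ('n space \<Rightarrow> 'n space) set \<Rightarrow> 'n space set set \<Rightarrow> bool" where
  "tiling \<P> G T \<longleftrightarrow> patch \<P> G T \<and> \<Union>T = UNIV"


text \<open>
  A colouring, a function on the disjoint union of the prototiles, is curried: \<open>g P x\<close> is the
  colour of the point \<open>x\<close> in the copy of \<open>P\<close>; the values for \<open>x \<notin> P\<close> are irrelevant.
\<close>

definition colouring :: "'n::finite space set set \<Rightarrow> 'c set \<Rightarrow> ('n space set \<Rightarrow> 'n space \<Rightarrow> 'c) \<Rightarrow> bool" where
  "colouring \<P> C g \<longleftrightarrow> (\<forall>P\<in>\<P>. g P \<in> P \<rightarrow> C)"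

definition facet_rule :: "'c set \<Rightarrow> 'c \<Rightarrow> ('c \<Rightarrow> 'c \<Rightarrow> bool) \<Rightarrow> bool" where
  "facet_rule C c\<^sub>0 r \<longleftrightarrow> c\<^sub>0 \<in> C \<and> (\<forall>x\<in>C. \<forall>y\<in>C. r x y = r y x) \<and> r c\<^sub>0 c\<^sub>0"

text \<open>
  A coloured tile is a tile \<open>t\<close> together with its colouring \<open>g\<^sub>t\<close>. The set \<open>t\<close> alone does
  not determine \<open>g\<^sub>t\<close>, since two prototiles may be translates of each other and be coloured
  differently. The colouring is cut off outside \<open>t\<close>, so that two coloured tiles are equal
  iff they agree as sets and in the colours of their points.
\<close>

type_synonym ('n, 'c) ctile = "'n space set \<times> ('n space \<Rightarrow> 'c)"

definition coloured_tile ::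
    "('n::finite space set \<Rightarrow> 'n space \<Rightarrow> 'c) \<Rightarrow> ('n space \<Rightarrow> 'n space) \<Rightarrow> 'n space set \<Rightarrow> ('n, 'c) ctile" where
  "coloured_tile g f P = (f ` P, restrict (\<lambda>x. g P (inv f x)) (f ` P))"

definition coloured_tiling ::
    "'n::finite space set set \<Rightarrow> ('n space \<Rightarrow> 'n space) set \<Rightarrow> ('n space set \<Rightarrow> 'n space \<Rightarrow> 'c)
      \<Rightarrow> ('n, 'c) ctile set \<Rightarrow> bool" where
  "coloured_tiling \<P> G g T \<longleftrightarrow>
     T \<subseteq> {coloured_tile g f P |f P. f \<in> G \<and> P \<in> \<P>} \<and> inj_on fst T \<and> tiling \<P> G (fst ` T)"

definition satisfies_facet_rule :: "('c \<Rightarrow> 'c \<Rightarrow> bool) \<Rightarrow> ('n::finite, 'c) ctile set \<Rightarrow> bool" where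
  "satisfies_facet_rule r T \<longleftrightarrow>
     (\<forall>t\<^sub>1\<in>T. \<forall>t\<^sub>2\<in>T. t\<^sub>1 \<noteq> t\<^sub>2 \<longrightarrow> (\<forall>x \<in> fst t\<^sub>1 \<inter> fst t\<^sub>2. r (snd t\<^sub>1 x) (snd t\<^sub>2 x)))"

definition facet_rule_tiling ::
    "'n::finite space set set \<Rightarrow> ('n space \<Rightarrow> 'n space) set \<Rightarrow> ('n space set \<Rightarrow> 'n space \<Rightarrow> 'c)
      \<Rightarrow> ('c \<Rightarrow> 'c \<Rightarrow> bool) \<Rightarrow> ('n, 'c) ctile set \<Rightarrow> bool" where
  "facet_rule_tiling \<P> G g r T \<longleftrightarrow> coloured_tiling \<P> G g T \<and> satisfies_facet_rule r T"


definition translate_patch :: "'n::finite space \<Rightarrow> 'n space set set \<Rightarrow> 'n space set set" where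
  "translate_patch v A = (\<lambda>t. (+) v ` t) ` A"

definition atlas_rule ::
    "'n::finite space set set \<Rightarrow> ('n space \<Rightarrow> 'n space) set \<Rightarrow> 'n space set set set \<Rightarrow> bool" where
  "atlas_rule X G \<U> \<longleftrightarrow> finite \<U> \<and> (\<forall>A\<in>\<U>. patch X G A \<and> compact (\<Union>A))"

text \<open>\<open>n t\<close> is the patch of \<open>T\<close> witnessing the rule at the tile \<open>t\<close>.\<close>

definition satisfies_atlas_via ::
    "('n::finite space set \<Rightarrow> 'n space set set) \<Rightarrow> 'n space set set set \<Rightarrow> 'n space set set \<Rightarrow> bool" where
  "satisfies_atlas_via n \<U> T \<longleftrightarrow>
     (\<forall>t\<in>T. n t \<subseteq> T \<and> t \<in> n t \<and> t \<subseteq> interior (\<Union>(n t)) \<and> (\<exists>A\<in>\<U>. \<exists>v. n t = translate_patch v A))"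

definition corona_patch :: "'n::finite space set set \<Rightarrow> 'n space set \<Rightarrow> 'n space set set" where
  "corona_patch T t = insert t {s \<in> T. s \<inter> t \<noteq> {}}"

text \<open>
  A patch \<open>A\<close> is a tile \<open>t\<close> together with its full 1-corona if it is its own corona patch of \<open>t\<close>
  and leaves no room next to \<open>t\<close> for further tiles.
\<close>

definition corona_atlas_rule ::
    "'n::finite space set set \<Rightarrow> ('n space \<Rightarrow> 'n space) set \<Rightarrow> 'n space set set set \<Rightarrow> bool" where
  "corona_atlas_rule X G \<U> \<longleftrightarrow>
     atlas_rule X G \<U> \<and> (\<forall>A\<in>\<U>. \<exists>t\<in>A. A = corona_patch A t \<and> t \<subseteq> interior (\<Union>A))"

definition corona_atlas_tiling ::
    "'n::finite space set set \<Rightarrow> ('n space \<Rightarrow> 'n space) set \<Rightarrow> 'n space set set set \<Rightarrow> 'n space set set \<Rightarrow> bool" where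
  "corona_atlas_tiling X G \<U> T \<longleftrightarrow>
     tiling X G T \<and> satisfies_atlas_via (corona_patch T) \<U> T"


text \<open>Uncoloured tilings are regarded as coloured ones with values in the one-element type.\<close>

definition uncoloured :: "'n::finite space set set \<Rightarrow> ('n, unit) ctile set" where
  "uncoloured T = (\<lambda>t. (t, \<lambda>_. ())) ` T"

definition translate_ctile :: "'n::finite space \<Rightarrow> ('n, 'c) ctile \<Rightarrow> ('n, 'c) ctile" where
  "translate_ctile v t = ((+) v ` fst t, \<lambda>x. snd t (x - v))"

definition patch_at :: "('n::finite, 'c) ctile set \<Rightarrow> real \<Rightarrow> 'n space \<Rightarrow> ('n, 'c) ctile set" where
  "patch_at T R x = {t \<in> T. fst t \<inter> cball x R \<noteq> {}}"

text \<open>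
  \<open>T'\<close> is locally derivable from \<open>T\<close>: for some radius \<open>R\<close>, the tiles of \<open>T'\<close> at a point are
  determined, up to the translation moving one point to the other, by the tiles of \<open>T\<close> meeting
  the ball of radius \<open>R\<close> around that point.
\<close>

definition locally_derivable :: "('n::finite, 'c) ctile set \<Rightarrow> ('n, 'd) ctile set \<Rightarrow> bool" where
  "locally_derivable T T' \<longleftrightarrow>
     (\<exists>R>0. \<forall>x y. patch_at T R y = translate_ctile (y - x) ` patch_at T R x
        \<longrightarrow> patch_at T' 0 y = translate_ctile (y - x) ` patch_at T' 0 x)"

definition MLD :: "('n::finite, 'c) ctile set \<Rightarrow> ('n, 'd) ctile set \<Rightarrow> bool" where
  "MLD T T' \<longleftrightarrow> locally_derivable T T' \<and> locally_derivable T' T"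

text \<open>
  Finite local complexity: up to translation there are only finitely many patches of any given
  radius. A finite atlas rule with patches taken up to translation imposes this on every tiling
  whose coronas obey the rule, and mutual local derivability preserves it. Hence it is necessary
  for being MLD to such a tiling. It is not automatic: in the tilings of the plane by
  translates of one unit square, the columns may slide against each other arbitrarily.
\<close>

definition finite_local_complexity :: "('n::finite, 'c) ctile set \<Rightarrow> bool" where
  "finite_local_complexity T \<longleftrightarrow>
     (\<forall>R>0. \<exists>F. finite F \<and> (\<forall>x. \<exists>A\<in>F. \<exists>v. patch_at T R x = translate_ctile v ` A))"

end

theory Submission
  imports Defs
begin

text \<open>
  Up to translation there are at most \<open>card \<P>\<close> coloured tiles. If they have pairwise distinct
  shapes, the shape of a tile determines its colouring and the colours can be forgotten. Otherwise
  there is room for one more prototile, a disconnected union \<open>h\<close> of three small cubes out of a row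
  of six. A row of nine cubes can be cut into isometric copies of \<open>h\<close> in two ways, so it stores one
  bit. Cut a hole consisting of many such rows out of every tile, and encode the colouring of the
  tile in the way the hole is filled. The volumes of the perforated shapes are made pairwise
  distinct and larger than that of any filling, so that a perforated tile reveals its shape and
  position, and the filling then reveals the colours. By finite local complexity there are only
  finitely many coronas up to translation, and they serve as the atlas.
\<close>

section \<open>Translations and isometric tiles\<close>

text \<open>The bound on the number of prototiles is the obstacle: a shape with several colourings
  may yield only one perforated prototile. So the hole depends on the shape alone, the filling tells
  the colouring, and all shapes share one further prototile. A hole in the interior leaves the
  boundary of a tile untouched, so neighbouring tiles do not interfere.

  Reflections are what lets a filling carry information. An interval of integers is tiled by
  translates of one finite set in at most one way, because the least uncovered integer must be the
  minimum of the next translate. The set \<open>{0,1,5}\<close> has no mirror symmetry, and three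
  copies of it, one or two of them reflected, fill nine cells in two ways. Since the set has gaps,
  the construction also works on the line, where a connected prototile would be an interval.

  Volume identifies perforated tiles because it is invariant under translation and tends to the
  volume of the whole shape as the cubes shrink. The atlas may depend on \<open>T\<close>: it
  consists of coronas of the new tiling itself.\<close>

lemma image_plus_plus: "(+) u ` (+) v ` (S :: 'a::ab_group_add set) = (+) (u + v) ` S"
  by (simp add: image_image add.assoc)

lemma translate_ctile_0 [simp]: "translate_ctile 0 t = t"
  by (simp add: translate_ctile_def)

lemma translate_ctile_add: "translate_ctile u (translate_ctile v t) = translate_ctile (u + v) t"
  by (simp add: translate_ctile_def image_image add.assoc diff_diff_eq)

lemma fst_translate_ctile [simp]: "fst (translate_ctile v t) = (+) v ` fst t"
  by (simp add: translate_ctile_def)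

lemma translate_ctile_eq_iff [simp]: "translate_ctile v s = translate_ctile v t \<longleftrightarrow> s = t"
proof
  assume "translate_ctile v s = translate_ctile v t"
  then have "translate_ctile (-v) (translate_ctile v s) = translate_ctile (-v) (translate_ctile v t)"
    by simp
  then show "s = t"
    by (simp only: translate_ctile_add) simp
qed simp

lemma inj_image_plus: "(+) v ` S = (+) v ` S' \<longleftrightarrow> S = (S' :: 'a::ab_group_add set)"
  by (simp add: inj_image_eq_iff)

lemma corona_patch_translate:
  "corona_patch (translate_patch v A) ((+) v ` s) = translate_patch v (corona_patch A s)"
proof -
  have "((+) v ` a \<inter> (+) v ` s = {}) = (a \<inter> s = {})" for a :: "'a space set"
    by (metis (no_types, lifting) empty_is_image image_Int inj_on_add)
  then show ?thesis
    unfolding corona_patch_def translate_patch_def by auto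
qed

lemma translate_patch_add: "translate_patch u (translate_patch v A) = translate_patch (u + v) A"
  by (simp add: translate_patch_def image_image add.assoc)

lemma isometry_group_dist: "f \<in> isometry_group \<Longrightarrow> dist (f x) (f y) = dist x y"
  by (simp add: isometry_group_def)

lemma compact_tiles:
  assumes "prototile_set X" "s \<in> tiles X isometry_group"
  shows "compact s"
proof -
  obtain f P where s: "s = f ` P" and f: "f \<in> isometry_group" and P: "P \<in> X"
    using assms(2) unfolding tiles_def by auto
  have "compact P"
    using assms(1) P by (auto simp: prototile_set_def)
  moreover have "continuous_on P f"
    unfolding continuous_on_iff using f by (auto simp: isometry_group_dist)
  ultimately show ?thesis
    unfolding s by (rule compact_continuous_image[rotated])
qed

lemma tiles_translate:
  assumes "s \<in> tiles X isometry_group"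
  shows "(+) v ` s \<in> tiles X isometry_group"
proof -
  obtain f P where s: "s = f ` P" and f: "f \<in> isometry_group" and P: "P \<in> X"
    using assms unfolding tiles_def by auto
  have "surj ((+) v \<circ> f)"
    using f by (intro comp_surj) (auto simp: isometry_group_def surj_plus)
  then have "(+) v \<circ> f \<in> isometry_group"
    using f by (auto simp: isometry_group_def)
  moreover have "(+) v ` s = ((+) v \<circ> f) ` P"
    by (simp add: s image_comp)
  ultimately show ?thesis
    unfolding tiles_def using P by blast
qed

lemma interior_image_plus: "interior ((+) v ` S) = (+) v ` interior (S :: 'a::euclidean_space set)"
  by (rule interior_translation)

text \<open>Disjoint interiors force the centres of inscribed balls of a common radius to be
  separated, so only finitely many of them lie in a bounded region.\<close>

lemma finite_tiles_meeting_bounded: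
  fixes Q F :: "'a::euclidean_space set set"
  assumes "finite Q" and Q: "\<And>q. q \<in> Q \<Longrightarrow> bounded q \<and> interior q \<noteq> {}"
    and F: "\<And>t. t \<in> F \<Longrightarrow> \<exists>v. \<exists>q\<in>Q. t = (+) v ` q"
    and disj: "pairwise (\<lambda>s t. interior s \<inter> interior t = {}) F"
    and "bounded B"
  shows "finite {t \<in> F. t \<inter> B \<noteq> {}}"
proof -
  have "\<exists>r>0. \<forall>q\<in>Q. \<exists>p. ball p r \<subseteq> interior q"
    using \<open>finite Q\<close> Q
  proof (induction Q rule: finite_induct)
    case empty
    then show ?case by (auto intro: exI[of _ 1])
  next
    case (insert q Q)
    then obtain r where r: "r > 0" "\<forall>q\<in>Q. \<exists>p. ball p r \<subseteq> interior q"
      by auto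
    obtain p where "p \<in> interior q"
      using insert.prems by blast
    then obtain e where e: "e > 0" "ball p e \<subseteq> interior q"
      using open_contains_ball open_interior by blast
    have "ball p (min r e) \<subseteq> interior q"
      using e by auto
    moreover have "\<forall>q\<in>Q. \<exists>p. ball p (min r e) \<subseteq> interior q"
      using r(2) by (meson min.cobounded1 order_trans subset_ball)
    ultimately show ?case
      using r(1) e(1) by (intro exI[of _ "min r e"]) auto
  qed
  then obtain r where r: "r > 0" "\<And>q. q \<in> Q \<Longrightarrow> \<exists>p. ball p r \<subseteq> interior q"
    by blast
  have "bounded (\<Union>Q)"
    using \<open>finite Q\<close> Q by (intro bounded_Union) auto
  then obtain d where d: "\<And>x. x \<in> \<Union>Q \<Longrightarrow> norm x \<le> d"
    by (auto simp: bounded_iff)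
  obtain M where M: "\<And>x. x \<in> B \<Longrightarrow> norm x \<le> M"
    using \<open>bounded B\<close> by (auto simp: bounded_iff)
  let ?F = "{t \<in> F. t \<inter> B \<noteq> {}}"
  have "\<exists>p. ball p r \<subseteq> interior t \<and> p \<in> cball 0 (M + 2 * d)" if tF: "t \<in> ?F" for t
  proof -
    obtain v q where q: "q \<in> Q" and t: "t = (+) v ` q"
      using F tF by blast
    obtain p where p: "ball p r \<subseteq> interior q"
      using r(2)[OF q] by blast
    have "p \<in> q"
      using p r(1) interior_subset by (metis centre_in_ball subsetD)
    obtain y where y: "y \<in> q" "v + y \<in> B"
      using tF t by auto
    \<comment> \<open>The centre \<open>v + p\<close> is the point \<open>v + y\<close> of
      \<open>B\<close> minus \<open>y - p\<close>, and both \<open>y\<close> and \<open>p\<close>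
      lie in \<open>q\<close>; hence the summand \<open>2 * d\<close>.\<close>
    have "norm ((v + y) - (y - p)) \<le> norm (v + y) + norm (y - p)"
      by (rule norm_triangle_ineq4)
    also have "\<dots> \<le> norm (v + y) + (norm y + norm p)"
      by (intro add_left_mono norm_triangle_ineq4)
    also have "\<dots> \<le> M + (d + d)"
      using M[OF y(2)] d y(1) \<open>p \<in> q\<close> q by (intro add_mono) auto
    finally have "norm (v + p) \<le> M + 2 * d"
      by (simp add: algebra_simps)
    moreover have "ball (v + p) r \<subseteq> interior t"
      unfolding t interior_image_plus ball_translation using p by (rule image_mono)
    ultimately show ?thesis
      by auto
  qed
  then obtain p where p: "\<And>t. t \<in> ?F \<Longrightarrow> ball (p t) r \<subseteq> interior t \<and> p t \<in> cball 0 (M + 2 * d)"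
    by metis
  \<comment> \<open>An \<open>r/2\<close>-net: two centres near the same net point are less than
    \<open>r\<close> apart, so one of them lies in both inscribed balls.\<close>
  have "\<exists>K. finite K \<and> cball (0::'a) (M + 2 * d) \<subseteq> (\<Union>x\<in>K. ball x (r/2))"
    using compact_cball[of "0::'a" "M + 2 * d"] r(1)
    unfolding compact_eq_totally_bounded by (auto dest!: spec[of _ "r/2"])
  then obtain K where K: "finite K" "cball 0 (M + 2 * d) \<subseteq> (\<Union>x\<in>K. ball (x::'a) (r/2))"
    by blast
  then have "\<forall>t\<in>?F. \<exists>x. x \<in> K \<and> p t \<in> ball x (r/2)"
    using p by blast
  from bchoice[OF this] obtain f where f: "\<And>t. t \<in> ?F \<Longrightarrow> f t \<in> K \<and> p t \<in> ball (f t) (r/2)"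
    by blast
  have "inj_on f ?F"
  proof (rule inj_onI, rule ccontr)
    fix s t assume st: "s \<in> ?F" "t \<in> ?F" "f s = f t" "s \<noteq> t"
    have "dist (f s) (p s) < r / 2" "dist (f s) (p t) < r / 2"
      using f[OF st(1)] f[OF st(2)] st(3) by auto
    then have "dist (p s) (p t) < r"
      by (metis dist_commute dist_triangle_half_r)
    then have "p t \<in> interior s" "p t \<in> interior t"
      using p[OF st(1)] p[OF st(2)] r(1) by auto
    then show False
      using disj st by (auto simp: pairwise_def)
  qed
  moreover have "f ` ?F \<subseteq> K"
    using f by auto
  ultimately show ?thesis
    using K(1) by (meson finite_imageD finite_subset)
qed

section \<open>Subdivided tilings\<close>

text \<open>The set \<open>E\<close> is arbitrary so that the same operation cuts the whole tiling,
  a finite patch or a translated patch. Members of \<open>E\<close> that are not translates of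
  elements of \<open>N\<close> contribute nothing.\<close>

definition subtiles ::
    "('n::finite, 'c) ctile set \<Rightarrow> (('n, 'c) ctile \<Rightarrow> 'n space set set) \<Rightarrow> ('n, 'c) ctile set
      \<Rightarrow> 'n space set set" where
  "subtiles N D E = {(+) v ` q |v c q. c \<in> N \<and> q \<in> D c \<and> translate_ctile v c \<in> E}"

lemma subtilesI:
  "c \<in> N \<Longrightarrow> q \<in> D c \<Longrightarrow> translate_ctile v c \<in> E \<Longrightarrow> (+) v ` q \<in> subtiles N D E"
  unfolding subtiles_def by (rule CollectI, rule exI[of _ v], rule exI[of _ c], rule exI[of _ q]) simp

lemma subtilesE:
  assumes "s \<in> subtiles N D E"
  obtains v c q where "s = (+) v ` q" "c \<in> N" "q \<in> D c" "translate_ctile v c \<in> E"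
  using assms unfolding subtiles_def mem_Collect_eq by (elim exE conjE)

lemma subtiles_mono: "E \<subseteq> E' \<Longrightarrow> subtiles N D E \<subseteq> subtiles N D E'"
  by (rule subsetI, erule subtilesE) (auto intro: subtilesI)

text \<open>A coloured tile is cut according to its representative in \<open>N\<close>, so cutting
  commutes with translations. This carries equalities of patches up to translation from
  \<open>T\<close> to the pieces.\<close>

lemma subtiles_translate: "subtiles N D (translate_ctile u ` E) = translate_patch u (subtiles N D E)"
proof (intro equalityI subsetI)
  fix s assume "s \<in> subtiles N D (translate_ctile u ` E)"
  then obtain v c q where *: "s = (+) v ` q" "c \<in> N" "q \<in> D c"
      "translate_ctile v c \<in> translate_ctile u ` E"
    by (rule subtilesE)
  then obtain e where e: "e \<in> E" "translate_ctile v c = translate_ctile u e"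
    by auto
  have "translate_ctile (v - u) c = translate_ctile (- u) (translate_ctile v c)"
    by (simp add: translate_ctile_add)
  also have "\<dots> = e"
    unfolding e(2) translate_ctile_add by simp
  finally have "(+) (v - u) ` q \<in> subtiles N D E"
    using * e(1) by (intro subtilesI) auto
  then have "(+) u ` (+) (v - u) ` q \<in> translate_patch u (subtiles N D E)"
    unfolding translate_patch_def by blast
  then show "s \<in> translate_patch u (subtiles N D E)"
    unfolding image_plus_plus *(1) by simp
next
  fix s assume "s \<in> translate_patch u (subtiles N D E)"
  then obtain s' where s': "s = (+) u ` s'" "s' \<in> subtiles N D E"
    by (auto simp: translate_patch_def)
  from s'(2) obtain v c q where *: "s' = (+) v ` q" "c \<in> N" "q \<in> D c" "translate_ctile v c \<in> E"
    by (rule subtilesE)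
  have "(+) (u + v) ` q \<in> subtiles N D (translate_ctile u ` E)"
    using * by (intro subtilesI) (auto simp flip: translate_ctile_add)
  then show "s \<in> subtiles N D (translate_ctile u ` E)"
    unfolding s' * image_plus_plus .
qed

text \<open>
  The set \<open>N\<close> has one coloured tile of each translation class, and \<open>D\<close> cuts it into tiles of the
  new tiling. The piece \<open>b c\<close> reveals the shape and the position of \<open>c\<close>, and two colourings of
  one shape are told apart by pieces which cannot occur together.
\<close>

locale subdivided_tiling =
  fixes N :: "('n::finite, 'c) ctile set" and D :: "('n, 'c) ctile \<Rightarrow> 'n space set set"
    and X :: "'n space set set" and b :: "('n, 'c) ctile \<Rightarrow> 'n space set"
    and T :: "('n, 'c) ctile set"
  assumes finite_N: "finite N"
    and canonical: "c \<in> N \<Longrightarrow> c' \<in> N \<Longrightarrow> translate_ctile v c = translate_ctile w c' \<Longrightarrow> c = c' \<and> v = w"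
    and interior_N: "c \<in> N \<Longrightarrow> interior (fst c) \<noteq> {}"
    and finite_D: "c \<in> N \<Longrightarrow> finite (D c)"
    and Union_D: "c \<in> N \<Longrightarrow> \<Union>(D c) = fst c"
    and disjoint_D: "c \<in> N \<Longrightarrow> pairwise (\<lambda>s t. interior s \<inter> interior t = {}) (D c)"
    and prototile_X: "prototile_set X"
    and D_tiles: "c \<in> N \<Longrightarrow> D c \<subseteq> tiles X isometry_group"
    and D_nonempty: "c \<in> N \<Longrightarrow> {} \<notin> D c"
    and b_in_D: "c \<in> N \<Longrightarrow> b c \<in> D c"
    and b_unique: "c \<in> N \<Longrightarrow> c' \<in> N \<Longrightarrow> q \<in> D c' \<Longrightarrow> (+) v ` b c = (+) w ` q \<Longrightarrow> v = w \<and> fst c = fst c'"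
    and distinguish: "c \<in> N \<Longrightarrow> c' \<in> N \<Longrightarrow> c \<noteq> c' \<Longrightarrow> fst c = fst c' \<Longrightarrow>
      \<exists>q\<in>D c. \<exists>q'\<in>D c'. q \<noteq> q' \<and> interior q \<inter> interior q' \<noteq> {}"
    and T_types: "t \<in> T \<Longrightarrow> \<exists>v. \<exists>c\<in>N. t = translate_ctile v c"
    and T_disjoint: "t \<in> T \<Longrightarrow> t' \<in> T \<Longrightarrow> t \<noteq> t' \<Longrightarrow> interior (fst t) \<inter> interior (fst t') = {}"
    and T_cover: "\<Union>(fst ` T) = UNIV"
    and T_flc: "finite_local_complexity T"
begin

section \<open>The pieces as a tiling, and decoding it\<close>

abbreviation "T' \<equiv> subtiles N D T"

lemma compact_piece: "c \<in> N \<Longrightarrow> q \<in> D c \<Longrightarrow> compact q"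
  using D_tiles prototile_X compact_tiles by blast

lemma compact_N: "c \<in> N \<Longrightarrow> compact (fst c)"
  using compact_piece finite_D Union_D by (metis compact_Union)

lemma piece_subset: "c \<in> N \<Longrightarrow> q \<in> D c \<Longrightarrow> q \<subseteq> fst c"
  using Union_D by blast

lemma compact_T': "s \<in> T' \<Longrightarrow> compact s"
  by (metis subtilesE compact_piece compact_translation)

lemma nonempty_T': "s \<in> T' \<Longrightarrow> s \<noteq> {}"
  by (metis subtilesE D_nonempty image_is_empty)

lemma T'_tiles: "s \<in> T' \<Longrightarrow> s \<in> tiles X isometry_group"
  by (metis subtilesE D_tiles tiles_translate subsetD)

text \<open>Pieces of one coloured tile are disjoint by \<open>disjoint_D\<close>, where
  \<open>canonical\<close> ensures that the tile determines \<open>c\<close> and \<open>v\<close>.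
  Pieces of different tiles inherit disjointness from the tiles.\<close>

lemma T'_disjoint: "pairwise (\<lambda>s t. interior s \<inter> interior t = {}) T'"
proof (rule pairwiseI)
  fix s s' assume "s \<in> T'" "s' \<in> T'" "s \<noteq> s'"
  obtain v c q where 1: "s = (+) v ` q" "c \<in> N" "q \<in> D c" "translate_ctile v c \<in> T"
    using \<open>s \<in> T'\<close> by (rule subtilesE)
  obtain v' c' q' where 2: "s' = (+) v' ` q'" "c' \<in> N" "q' \<in> D c'" "translate_ctile v' c' \<in> T"
    using \<open>s' \<in> T'\<close> by (rule subtilesE)
  show "interior s \<inter> interior s' = {}"
  proof (cases "translate_ctile v c = translate_ctile v' c'")
    case True
    then have eq: "c' = c" "v' = v"
      using canonical 1 2 by blast+
    have "q \<noteq> q'"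
      using \<open>s \<noteq> s'\<close> 1 2 eq by auto
    then have "interior q \<inter> interior q' = {}"
      using disjoint_D 1(2,3) 2(3) eq by (auto simp: pairwise_def)
    then show ?thesis
      by (auto simp: 1(1) 2(1) eq interior_image_plus)
  next
    case False
    have "interior s \<subseteq> interior (fst (translate_ctile v c))"
      "interior s' \<subseteq> interior (fst (translate_ctile v' c'))"
      using piece_subset[OF 1(2,3)] piece_subset[OF 2(2,3)]
      by (simp_all add: 1(1) 2(1) interior_mono image_mono)
    then show ?thesis
      using T_disjoint[OF 1(4) 2(4) False] by blast
  qed
qed

lemma T'_cover: "\<Union>T' = UNIV"
proof -
  have "x \<in> \<Union>T'" for x
  proof -
    obtain t where t: "t \<in> T" "x \<in> fst t"
      using T_cover by blast
    obtain v c where c: "c \<in> N" "t = translate_ctile v c"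
      using T_types t by blast
    obtain q where "q \<in> D c" "x \<in> (+) v ` q"
      using t(2) Union_D[OF c(1)] by (auto simp: c(2))
    then show ?thesis
      using c t by (auto intro: subtilesI)
  qed
  then show ?thesis by blast
qed

text \<open>The piece \<open>b c\<close> comes from some tile of \<open>T\<close>, which by
  \<open>b_unique\<close> has the shape of \<open>c\<close> at the same place. If it had another
  colouring, \<open>distinguish\<close> would give two different overlapping pieces in
  \<open>T'\<close>.\<close>

lemma decode:
  assumes c: "c \<in> N" and sub: "\<And>q. q \<in> D c \<Longrightarrow> (+) v ` q \<in> T'"
  shows "translate_ctile v c \<in> T"
proof -
  obtain w c' q where 1: "(+) v ` b c = (+) w ` q" "c' \<in> N" "q \<in> D c'" "translate_ctile w c' \<in> T"
    using sub[OF b_in_D[OF c]] by (rule subtilesE)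
  have eq: "w = v" "fst c = fst c'"
    using b_unique[OF c 1(2,3,1)] by auto
  have "c = c'"
  proof (rule ccontr)
    assume "c \<noteq> c'"
    then obtain q q' where q: "q \<in> D c" "q' \<in> D c'" "q \<noteq> q'" "interior q \<inter> interior q' \<noteq> {}"
      using distinguish[OF c 1(2) _ eq(2)] by blast
    have "(+) v ` q \<in> T'" "(+) v ` q' \<in> T'"
      using sub[OF q(1)] subtilesI[of c' N q' D w T] 1 q(2) eq by auto
    moreover have "(+) v ` q \<noteq> (+) v ` q'"
      using q(3) by (simp add: inj_image_plus)
    ultimately have "interior ((+) v ` q) \<inter> interior ((+) v ` q') = {}"
      using T'_disjoint by (auto simp: pairwise_def)
    then show False
      using q(4) by (auto simp: interior_image_plus)
  qed
  then show ?thesis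
    using 1(4) eq by simp
qed

section \<open>Local finiteness\<close>

text \<open>Counting shapes suffices: two tiles of \<open>T\<close> with the same underlying set
  would have overlapping interiors, so \<open>fst\<close> is injective on \<open>T\<close>.\<close>

lemma finite_T_meeting:
  assumes "bounded B"
  shows "finite {t \<in> T. fst t \<inter> B \<noteq> {}}"
proof -
  have inj: "inj_on fst T"
  proof (rule inj_onI, rule ccontr)
    fix s t assume st: "s \<in> T" "t \<in> T" "fst s = fst t" "s \<noteq> t"
    obtain v c where "c \<in> N" "s = translate_ctile v c"
      using T_types st by blast
    then have "interior (fst s) \<noteq> {}"
      using interior_N[of c] by (simp add: interior_image_plus)
    then show False
      using T_disjoint[OF st(1,2,4)] st(3) by simp
  qed
  have "finite {S \<in> fst ` T. S \<inter> B \<noteq> {}}"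
  proof (rule finite_tiles_meeting_bounded[of "fst ` N"])
    show "\<exists>v. \<exists>q\<in>fst ` N. S = (+) v ` q" if S: "S \<in> fst ` T" for S
    proof -
      obtain t where t: "t \<in> T" "S = fst t"
        using S by auto
      then obtain v c where "c \<in> N" "t = translate_ctile v c"
        using T_types by blast
      then show ?thesis
        using t by auto
    qed
    show "pairwise (\<lambda>s t. interior s \<inter> interior t = {}) (fst ` T)"
    proof (rule pairwiseI)
      fix A B assume "A \<in> fst ` T" "B \<in> fst ` T" "A \<noteq> B"
      then obtain s t where "s \<in> T" "t \<in> T" "A = fst s" "B = fst t"
        by blast
      then show "interior A \<inter> interior B = {}"
        using T_disjoint[of s t] \<open>A \<noteq> B\<close> by blast
    qed
  next
    show "bounded q \<and> interior q \<noteq> {}" if "q \<in> fst ` N" for q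
      using that compact_N interior_N by (blast intro: compact_imp_bounded)
  qed (use finite_N assms in auto)
  then have "finite (fst ` {t \<in> T. fst t \<inter> B \<noteq> {}})"
    by (rule rev_finite_subset) auto
  then show ?thesis
    by (rule finite_imageD) (use inj in \<open>auto simp: inj_on_def\<close>)
qed

text \<open>By \<open>canonical\<close> a coloured tile is a translate of each \<open>c\<close> by
  at most one vector, so every member of \<open>E\<close> gives finitely many pieces.\<close>

lemma finite_subtiles:
  assumes "finite E"
  shows "finite (subtiles N D E)"
proof -
  have sub: "subtiles N D {t} \<subseteq> (\<Union>c\<in>N. \<Union>v\<in>{v. translate_ctile v c = t}. (`) ((+) v) ` D c)" for t
    by (auto simp: subtiles_def)
  have "finite {v. translate_ctile v c = t}" if "c \<in> N" for c t
  proof (cases "\<exists>w. translate_ctile w c = t")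
    case True
    then obtain w where "translate_ctile w c = t" by blast
    then have "{v. translate_ctile v c = t} \<subseteq> {w}"
      using canonical[OF that that] by blast
    then show ?thesis
      by (rule finite_subset) simp
  qed auto
  then have "finite (subtiles N D {t})" for t
    using finite_N finite_D by (intro finite_subset[OF sub]) auto
  moreover have "subtiles N D E = (\<Union>t\<in>E. subtiles N D {t})"
    unfolding subtiles_def by blast
  ultimately show ?thesis
    using assms by simp
qed

lemma finite_T'_meeting:
  assumes "bounded B"
  shows "finite {s \<in> T'. s \<inter> B \<noteq> {}}"
proof (rule finite_subset)
  show "finite (subtiles N D {t \<in> T. fst t \<inter> B \<noteq> {}})"
    by (intro finite_subtiles finite_T_meeting assms)
  show "{s \<in> T'. s \<inter> B \<noteq> {}} \<subseteq> subtiles N D {t \<in> T. fst t \<inter> B \<noteq> {}}"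
  proof clarify
    fix s assume "s \<in> T'" "s \<inter> B \<noteq> {}"
    obtain v c q where 1: "s = (+) v ` q" "c \<in> N" "q \<in> D c" "translate_ctile v c \<in> T"
      using \<open>s \<in> T'\<close> by (rule subtilesE)
    have "s \<subseteq> (+) v ` fst c"
      using 1 piece_subset by blast
    then have "translate_ctile v c \<in> {t \<in> T. fst t \<inter> B \<noteq> {}}"
      using \<open>s \<inter> B \<noteq> {}\<close> 1(4) by auto
    then show "s \<in> subtiles N D {t \<in> T. fst t \<inter> B \<noteq> {}}"
      unfolding 1(1) using 1 by (intro subtilesI)
  qed
qed

text \<open>A ball of this radius around any point of a tile contains the whole tile; it is the
  radius at which coronas are determined by \<open>T\<close> and at which \<open>T\<close> is
  decoded from \<open>T'\<close>.\<close>

lemma diameter_bound: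
  obtains d where "d > 0" "\<And>c v x y. c \<in> N \<Longrightarrow> x \<in> (+) v ` fst c \<Longrightarrow> y \<in> (+) v ` fst c \<Longrightarrow> dist x y \<le> d"
proof -
  have "bounded (\<Union>(fst ` N))"
    using finite_N compact_N compact_imp_bounded by (intro bounded_Union) auto
  then obtain d where d: "d > 0" "\<And>x. x \<in> \<Union>(fst ` N) \<Longrightarrow> norm x \<le> d"
    by (auto simp: bounded_pos)
  have "dist x y \<le> 2 * d" if cxy: "c \<in> N" "x \<in> (+) v ` fst c" "y \<in> (+) v ` fst c" for c v x y
  proof -
    obtain x' y' where xy: "x' \<in> fst c" "y' \<in> fst c" "x = v + x'" "y = v + y'"
      using cxy(2,3) by (auto simp: image_iff)
    have "dist x y \<le> norm x' + norm y'"
      by (simp add: xy dist_norm norm_triangle_ineq4)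
    also have "\<dots> \<le> d + d"
      using d(2) xy cxy(1) by (intro add_mono) auto
    finally show ?thesis by simp
  qed
  then show ?thesis
    using that[of "2 * d"] d(1) by auto
qed

section \<open>The atlas of coronas\<close>

lemma tiling_T': "tiling X isometry_group T'"
  unfolding tiling_def patch_def using T'_tiles T'_disjoint T'_cover by auto

lemma finite_corona: "s \<in> T' \<Longrightarrow> finite (corona_patch T' s)"
  unfolding corona_patch_def
  by (intro finite.insertI finite_T'_meeting compact_imp_bounded compact_T')

text \<open>Only finitely many tiles near \<open>x\<close> miss \<open>x\<close>, and they are
  closed. Removing them from a ball leaves a neighbourhood of \<open>x\<close> covered by tiles
  through \<open>x\<close>, all of which touch \<open>s\<close>.\<close>

lemma subset_interior_corona:
  assumes s: "s \<in> T'"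
  shows "s \<subseteq> interior (\<Union>(corona_patch T' s))"
proof
  fix x assume x: "x \<in> s"
  let ?F = "{t \<in> T'. t \<inter> ball x 1 \<noteq> {} \<and> x \<notin> t}"
  have "finite ?F"
    by (rule finite_subset[OF _ finite_T'_meeting[of "ball x 1"]]) auto
  then have "closed (\<Union>?F)"
    using compact_T' by (intro closed_Union) (auto intro: compact_imp_closed)
  then have "open (ball x 1 - \<Union>?F)"
    by (intro open_Diff) auto
  moreover have "ball x 1 - \<Union>?F \<subseteq> \<Union>(corona_patch T' s)"
  proof
    fix y assume y: "y \<in> ball x 1 - \<Union>?F"
    obtain t where "t \<in> T'" "y \<in> t"
      using T'_cover by blast
    then have "x \<in> t"
      using y by blast
    then show "y \<in> \<Union>(corona_patch T' s)"
      using x \<open>t \<in> T'\<close> \<open>y \<in> t\<close> by (auto simp: corona_patch_def)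
  qed
  moreover have "x \<in> ball x 1 - \<Union>?F"
    by auto
  ultimately show "x \<in> interior (\<Union>(corona_patch T' s))"
    by (meson interiorI)
qed

lemma corona_atlas_rule_coronas:
  assumes "finite U" and U: "\<And>A. A \<in> U \<Longrightarrow> \<exists>s\<in>T'. A = corona_patch T' s"
  shows "corona_atlas_rule X isometry_group U"
proof -
  have "patch X isometry_group A \<and> compact (\<Union>A) \<and> (\<exists>t\<in>A. A = corona_patch A t \<and> t \<subseteq> interior (\<Union>A))"
    if AU: "A \<in> U" for A
  proof -
    obtain s where s: "s \<in> T'" and A: "A = corona_patch T' s"
      using U[OF AU] by blast
    have sub: "A \<subseteq> T'"
      using s by (auto simp: A corona_patch_def)
    have "patch X isometry_group A"
      using sub tiling_T' unfolding tiling_def patch_def by (meson order_trans pairwise_subset)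
    moreover have "compact (\<Union>A)"
      using finite_corona[OF s] sub compact_T' A by (intro compact_Union) auto
    moreover have "s \<in> A" "A = corona_patch A s"
      by (auto simp: A corona_patch_def)
    ultimately show ?thesis
      using subset_interior_corona[OF s] A by blast
  qed
  then show ?thesis
    using assms(1) unfolding corona_atlas_rule_def atlas_rule_def by blast
qed

text \<open>Pieces touching \<open>s\<close> belong to tiles of \<open>T\<close> that meet the ball
  of radius \<open>d\<close> around any chosen point of \<open>s\<close>. So the corona is computed
  from a patch of \<open>T\<close>, of which there are finitely many up to translation.\<close>

lemma finitely_many_coronas:
  "\<exists>K. finite K \<and> (\<forall>s\<in>T'. \<exists>A\<in>K. \<exists>v. corona_patch T' s = translate_patch v A)"
proof -
  obtain d where d: "d > 0"
      "\<And>c v x y. c \<in> N \<Longrightarrow> x \<in> (+) v ` fst c \<Longrightarrow> y \<in> (+) v ` fst c \<Longrightarrow> dist x y \<le> d"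
    using diameter_bound by blast
  obtain F where F: "finite F" "\<And>x. \<exists>A\<in>F. \<exists>v. patch_at T d x = translate_ctile v ` A"
    using T_flc d(1) unfolding finite_local_complexity_def by meson
  \<comment> \<open>The members of \<open>F\<close> are arbitrary sets; infinite ones represent no
    patch of \<open>T\<close> and would spoil the finiteness of \<open>?K\<close>.\<close>
  let ?K = "\<Union>A\<in>{A \<in> F. finite A}. corona_patch (subtiles N D A) ` subtiles N D A"
  have "finite ?K"
    using F(1) by (auto intro: finite_subtiles)
  moreover have "\<exists>A\<in>?K. \<exists>v. corona_patch T' s = translate_patch v A" if s: "s \<in> T'" for s
  proof -
    obtain w c q where 1: "s = (+) w ` q" "c \<in> N" "q \<in> D c" "translate_ctile w c \<in> T"
      using s by (rule subtilesE)
    have s_sub: "s \<subseteq> (+) w ` fst c"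
      using 1 piece_subset by blast
    obtain x where x: "x \<in> s"
      using nonempty_T'[OF s] by blast
    obtain A v where A: "A \<in> F" "patch_at T d x = translate_ctile v ` A"
      using F(2) by blast
    have "finite (patch_at T d x)"
      unfolding patch_at_def by (rule finite_T_meeting) simp
    then have finA: "finite A"
      unfolding A(2) by (rule finite_imageD) (simp add: inj_on_def)
    have meet: "t \<in> subtiles N D (patch_at T d x)" if t: "t \<in> T'" "t \<inter> s \<noteq> {}" for t
    proof -
      obtain w' c' q' where 2: "t = (+) w' ` q'" "c' \<in> N" "q' \<in> D c'" "translate_ctile w' c' \<in> T"
        using t(1) by (rule subtilesE)
      obtain y where y: "y \<in> t" "y \<in> s"
        using t(2) by blast
      then have "dist x y \<le> d"
        using d(2)[OF 1(2), of x w y] x s_sub by (simp add: subsetD)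
      moreover have "y \<in> (+) w' ` fst c'"
        using 2 y(1) piece_subset by blast
      ultimately have "translate_ctile w' c' \<in> patch_at T d x"
        using 2(4) by (auto simp: patch_at_def)
      then show ?thesis
        unfolding 2(1) using 2 by (intro subtilesI)
    qed
    have "subtiles N D (patch_at T d x) \<subseteq> T'"
      by (rule subtiles_mono) (auto simp: patch_at_def)
    then have "corona_patch T' s = corona_patch (subtiles N D (patch_at T d x)) s"
      using meet unfolding corona_patch_def by blast
    also have "subtiles N D (patch_at T d x) = translate_patch v (subtiles N D A)"
      unfolding A(2) by (rule subtiles_translate)
    finally have eq: "corona_patch T' s = corona_patch (translate_patch v (subtiles N D A)) s" .
    have "s \<in> subtiles N D (patch_at T d x)"
      using meet s x by blast
    then obtain s\<^sub>0 where s0: "s\<^sub>0 \<in> subtiles N D A" "s = (+) v ` s\<^sub>0"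
      unfolding A(2) subtiles_translate by (auto simp: translate_patch_def)
    have "corona_patch T' s = corona_patch (translate_patch v (subtiles N D A)) ((+) v ` s\<^sub>0)"
      using eq s0(2) by simp
    also have "\<dots> = translate_patch v (corona_patch (subtiles N D A) s\<^sub>0)"
      by (rule corona_patch_translate)
    finally show ?thesis
      using A(1) finA s0(1) by blast
  qed
  ultimately show ?thesis
    by blast
qed

lemma corona_atlas: "\<exists>U. corona_atlas_rule X isometry_group U \<and> corona_atlas_tiling X isometry_group U T'"
proof -
  obtain K where K: "finite K" "\<forall>s\<in>T'. \<exists>A\<in>K. \<exists>v. corona_patch T' s = translate_patch v A"
    using finitely_many_coronas by blast
  \<comment> \<open>A member of \<open>K\<close> need not be a patch of tiles. Only the classes that
    occur are kept, and each is replaced by an actual corona of \<open>T'\<close>.\<close>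
  define K' where "K' = {A \<in> K. \<exists>s\<in>T'. \<exists>v. corona_patch T' s = translate_patch v A}"
  have "\<forall>A\<in>K'. \<exists>s. s \<in> T' \<and> (\<exists>v. corona_patch T' s = translate_patch v A)"
    unfolding K'_def by blast
  then obtain s where s: "\<And>A. A \<in> K' \<Longrightarrow> s A \<in> T' \<and> (\<exists>v. corona_patch T' (s A) = translate_patch v A)"
    by metis
  define U where "U = (\<lambda>A. corona_patch T' (s A)) ` K'"
  have "corona_atlas_rule X isometry_group U"
    using s K(1) by (intro corona_atlas_rule_coronas) (auto simp: U_def K'_def)
  moreover have "satisfies_atlas_via (corona_patch T') U T'"
    unfolding satisfies_atlas_via_def
  proof (intro ballI conjI)
    fix t assume t: "t \<in> T'"
    obtain A v where A: "A \<in> K" "corona_patch T' t = translate_patch v A"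
      using K(2) t by blast
    then have "A \<in> K'"
      using t K'_def by blast
    then obtain w where w: "corona_patch T' (s A) = translate_patch w A"
      using s by blast
    have "corona_patch T' t = translate_patch (v - w) (corona_patch T' (s A))"
      by (simp add: A(2) w translate_patch_add)
    then show "\<exists>A\<in>U. \<exists>v. corona_patch T' t = translate_patch v A"
      unfolding U_def using \<open>A \<in> K'\<close> by blast
  qed (use subset_interior_corona in \<open>auto simp: corona_patch_def\<close>)
  ultimately show ?thesis
    unfolding corona_atlas_tiling_def using tiling_T' by blast
qed

section \<open>Mutual local derivability\<close>

lemma patch_at_uncoloured: "patch_at (uncoloured S) R x = (\<lambda>s. (s, \<lambda>_. ())) ` {s \<in> S. s \<inter> cball x R \<noteq> {}}"
  by (simp add: patch_at_def uncoloured_def Compr_image_eq)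

lemma translate_uncoloured:
  "translate_ctile v ` (\<lambda>s. (s, \<lambda>_. ())) ` S = (\<lambda>s. (s, \<lambda>_. ())) ` translate_patch v S"
  unfolding translate_ctile_def translate_patch_def image_image fst_conv snd_conv ..

lemma translate_patch_meeting:
  "translate_patch (y - x) {s \<in> S. s \<inter> cball x R \<noteq> {}} =
   {s \<in> translate_patch (y - x) S. s \<inter> cball y R \<noteq> {}}" for S :: "'n space set set"
proof -
  have "cball y R = (+) (y - x) ` cball x R"
    by (simp flip: cball_translation)
  then have "((+) (y - x) ` s \<inter> cball y R = {}) \<longleftrightarrow> s \<inter> cball x R = {}" for s
    by (metis (no_types, lifting) empty_is_image image_Int inj_on_add)
  then show ?thesis
    by (auto simp: translate_patch_def)
qed

text \<open>A piece through \<open>z\<close> lies in a tile of \<open>T\<close> through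
  \<open>z\<close>, so the tiles at \<open>z\<close> already determine it. The radius 1 is an
  arbitrary positive number.\<close>

lemma derivable_T': "locally_derivable T (uncoloured T')"
  unfolding locally_derivable_def
proof (intro exI[of _ 1] conjI allI impI)
  fix x y assume eq: "patch_at T 1 y = translate_ctile (y - x) ` patch_at T 1 x"
  have at: "{s \<in> T'. s \<inter> cball z 0 \<noteq> {}} = {s \<in> subtiles N D (patch_at T 1 z). s \<inter> cball z 0 \<noteq> {}}" for z
  proof (intro equalityI subsetI)
    fix s assume s: "s \<in> {s \<in> T'. s \<inter> cball z 0 \<noteq> {}}"
    then obtain v c q where 1: "s = (+) v ` q" "c \<in> N" "q \<in> D c" "translate_ctile v c \<in> T"
      by (auto elim: subtilesE)
    have "z \<in> s" using s by auto
    then have "z \<in> (+) v ` fst c"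
      using 1 piece_subset by blast
    moreover have "z \<in> cball z 1" by simp
    ultimately have "translate_ctile v c \<in> patch_at T 1 z"
      using 1(4) unfolding patch_at_def by fastforce
    then show "s \<in> {s \<in> subtiles N D (patch_at T 1 z). s \<inter> cball z 0 \<noteq> {}}"
      using s 1 by (auto intro: subtilesI)
  next
    fix s assume "s \<in> {s \<in> subtiles N D (patch_at T 1 z). s \<inter> cball z 0 \<noteq> {}}"
    moreover have "subtiles N D (patch_at T 1 z) \<subseteq> T'"
      by (rule subtiles_mono) (auto simp: patch_at_def)
    ultimately show "s \<in> {s \<in> T'. s \<inter> cball z 0 \<noteq> {}}"
      by auto
  qed
  show "patch_at (uncoloured T') 0 y = translate_ctile (y - x) ` patch_at (uncoloured T') 0 x"
    unfolding patch_at_uncoloured translate_uncoloured at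
    unfolding translate_patch_meeting eq subtiles_translate ..
qed simp

text \<open>All pieces of a tile through \<open>x\<close> meet the ball of radius \<open>d\<close>
  around \<open>x\<close>, so their translates occur around \<open>y\<close>, and
  \<open>decode\<close> reassembles them to the translated coloured tile.\<close>

lemma derivable_T: "locally_derivable (uncoloured T') T"
proof -
  obtain d where d: "d > 0"
      "\<And>c v x y. c \<in> N \<Longrightarrow> x \<in> (+) v ` fst c \<Longrightarrow> y \<in> (+) v ` fst c \<Longrightarrow> dist x y \<le> d"
    using diameter_bound by blast
  have sub: "translate_ctile (y - x) ` patch_at T 0 x \<subseteq> patch_at T 0 y"
    if eq: "patch_at (uncoloured T') d y = translate_ctile (y - x) ` patch_at (uncoloured T') d x" for x y
  proof
    have inj: "inj (\<lambda>s::'n space set. (s, \<lambda>_::'n space. ()))"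
      by (auto simp: inj_on_def)
    have eq': "{s \<in> T'. s \<inter> cball y d \<noteq> {}} = translate_patch (y - x) {s \<in> T'. s \<inter> cball x d \<noteq> {}}"
      using eq unfolding patch_at_uncoloured translate_uncoloured inj_image_eq_iff[OF inj] .
    fix t' assume "t' \<in> translate_ctile (y - x) ` patch_at T 0 x"
    then obtain t where t: "t \<in> T" "x \<in> fst t" "t' = translate_ctile (y - x) t"
      by (auto simp: patch_at_def)
    obtain v c where c: "c \<in> N" "t = translate_ctile v c"
      using T_types t by blast
    have "translate_ctile ((y - x) + v) c \<in> T"
    proof (rule decode[OF c(1)])
      fix q assume q: "q \<in> D c"
      have "(+) v ` q \<in> T'"
        using c q t by (auto intro: subtilesI)
      moreover have "(+) v ` q \<inter> cball x d \<noteq> {}"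
      proof -
        obtain z where "z \<in> q"
          using D_nonempty[OF c(1)] q by (metis all_not_in_conv)
        then have "v + z \<in> (+) v ` fst c"
          using piece_subset c q by blast
        then have "dist x (v + z) \<le> d"
          using d(2)[OF c(1)] t(2) by (simp add: c(2))
        then show ?thesis
          using \<open>z \<in> q\<close> by auto
      qed
      ultimately have "(+) (y - x) ` (+) v ` q \<in> {s \<in> T'. s \<inter> cball y d \<noteq> {}}"
        unfolding eq' translate_patch_def by blast
      then show "(+) (y - x + v) ` q \<in> T'"
        unfolding image_plus_plus by blast
    qed
    then have "t' \<in> T"
      unfolding t(3) c(2) translate_ctile_add .
    moreover have "y \<in> fst t'"
      unfolding t(3) fst_translate_ctile using t(2) by (rule image_eqI[rotated]) simp
    ultimately show "t' \<in> patch_at T 0 y"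
      by (auto simp: patch_at_def)
  qed
  show ?thesis
    unfolding locally_derivable_def
  proof (intro exI[of _ d] conjI allI impI)
    fix x y assume eq: "patch_at (uncoloured T') d y = translate_ctile (y - x) ` patch_at (uncoloured T') d x"
    \<comment> \<open>The reverse inclusion is \<open>sub\<close> with \<open>x\<close> and
      \<open>y\<close> exchanged, translated back.\<close>
    have "patch_at (uncoloured T') d x = translate_ctile (x - y) ` patch_at (uncoloured T') d y"
      unfolding eq image_image translate_ctile_add by simp
    then have "translate_ctile (x - y) ` patch_at T 0 y \<subseteq> patch_at T 0 x"
      by (rule sub)
    then have "translate_ctile (y - x) ` translate_ctile (x - y) ` patch_at T 0 y \<subseteq> translate_ctile (y - x) ` patch_at T 0 x"
      by (rule image_mono)
    then have "patch_at T 0 y \<subseteq> translate_ctile (y - x) ` patch_at T 0 x"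
      unfolding image_image translate_ctile_add by simp
    then show "patch_at T 0 y = translate_ctile (y - x) ` patch_at T 0 x"
      using sub[OF eq] by blast
  qed (rule d(1))
qed

lemma exists_corona_atlas_tiling:
  "\<exists>U T''. corona_atlas_rule X isometry_group U \<and> corona_atlas_tiling X isometry_group U T'' \<and>
     MLD T (uncoloured T'')"
proof -
  have "MLD T (uncoloured T')"
    unfolding MLD_def using derivable_T derivable_T' by simp
  then show ?thesis
    using corona_atlas by blast
qed

end

section \<open>Rows of cubes\<close>

definition cell :: "'n::finite \<Rightarrow> real \<Rightarrow> 'n space \<Rightarrow> nat \<Rightarrow> 'n space set" where
  "cell k \<delta> a c = cbox (a + axis k (real c * \<delta>)) (a + axis k (real c * \<delta>) + vec \<delta>)"

text \<open>Sets of indices stand for unions of cubes in a row in direction \<open>k\<close>, which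
  reduces the geometry of the fillings to tilings of intervals of natural numbers.\<close>

definition bar :: "'n::finite \<Rightarrow> real \<Rightarrow> 'n space \<Rightarrow> nat set \<Rightarrow> 'n space set" where
  "bar k \<delta> a Z = (\<Union>c\<in>Z. cell k \<delta> a c)"

lemma mem_cell:
  "x \<in> cell k \<delta> a c \<longleftrightarrow> (\<forall>i. a $ i + (if i = k then real c * \<delta> else 0) \<le> x $ i \<and>
     x $ i \<le> a $ i + (if i = k then real c * \<delta> else 0) + \<delta>)"
  unfolding cell_def mem_box_cart by (rule all_cong1) (simp add: axis_def)

lemma cell_plus: "cell k \<delta> (v + a) c = (+) v ` cell k \<delta> a c"
  by (simp add: cell_def cbox_translation add.assoc)

lemma bar_plus: "(+) v ` bar k \<delta> a Z = bar k \<delta> (v + a) Z"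
  by (simp add: bar_def cell_plus image_UN)

lemma cell_shift: "cell k \<delta> a (s + c) = cell k \<delta> (a + axis k (real s * \<delta>)) c"
proof -
  have "axis k (real (s + c) * \<delta>) = axis k (real s * \<delta>) + axis k (real c * \<delta>)"
    by (simp add: axis_def vec_eq_iff algebra_simps)
  then show ?thesis
    by (simp add: cell_def add.assoc)
qed

lemma bar_shift: "bar k \<delta> a ((+) s ` Z) = bar k \<delta> (a + axis k (real s * \<delta>)) Z"
  by (simp add: bar_def cell_shift)

text \<open>Reflection of the \<open>k\<close>-th coordinate followed by translation by
  \<open>a\<close>. It reverses the order of the cells in a row.\<close>

definition flip :: "'n::finite \<Rightarrow> 'n space \<Rightarrow> 'n space \<Rightarrow> 'n space" where
  "flip k a x = (\<chi> i. if i = k then a $ i - x $ i else a $ i + x $ i)"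

lemma flip_isometry: "flip k a \<in> isometry_group"
proof -
  have "surj (flip k a)"
    by (rule surjI[of _ "\<lambda>y. \<chi> i. if i = k then a $ i - y $ i else y $ i - a $ i"])
      (simp add: flip_def vec_eq_iff)
  moreover have "dist (flip k a x) (flip k a y) = dist x y" for x y
  proof -
    have "dist (flip k a x $ i) (flip k a y $ i) = dist (x $ i) (y $ i)" for i
      by (simp add: flip_def dist_real_def abs_minus_commute)
    then show ?thesis
      by (simp add: dist_vec_def)
  qed
  ultimately show ?thesis
    by (simp add: isometry_group_def)
qed

text \<open>The cell \<open>c\<close> extends from \<open>c * \<delta>\<close> to
  \<open>(c + 1) * \<delta>\<close> in direction \<open>k\<close>, and its upper end becomes the
  lower end of the image; hence \<open>Suc s\<close> in the reflection.\<close>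

lemma cell_flip:
  assumes "c \<le> s"
  shows "flip k (a + axis k (real (Suc s) * \<delta>)) ` cell k \<delta> 0 c = cell k \<delta> a (s - c)"
proof -
  let ?f = "flip k (a + axis k (real (Suc s) * \<delta>))"
  \<comment> \<open>The inverse of \<open>?f\<close>: the reflected coordinate is an involution, in
    the others the translation changes sign.\<close>
  let ?g = "flip k (\<chi> i. if i = k then (a + axis k (real (Suc s) * \<delta>)) $ i else - (a + axis k (real (Suc s) * \<delta>)) $ i)"
  have s: "real (s - c) = real s - real c"
    using assms by (simp add: of_nat_diff)
  have f: "?f x \<in> cell k \<delta> a (s - c)" if "x \<in> cell k \<delta> 0 c" for x
    using that unfolding mem_cell s by (auto simp: flip_def axis_def algebra_simps split: if_splits)
  have g: "?g x \<in> cell k \<delta> 0 c" if "x \<in> cell k \<delta> a (s - c)" for x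
    using that unfolding mem_cell s by (auto simp: flip_def axis_def algebra_simps split: if_splits)
  have fg: "x = ?f (?g x)" for x
    by (simp add: flip_def vec_eq_iff)
  show ?thesis
  proof (intro equalityI subsetI)
    fix x assume "x \<in> cell k \<delta> a (s - c)"
    then show "x \<in> ?f ` cell k \<delta> 0 c"
      by (intro image_eqI[of _ ?f, OF fg] g)
  qed (use f in blast)
qed

lemma bar_flip:
  assumes "\<And>c. c \<in> Z \<Longrightarrow> c \<le> s"
  shows "bar k \<delta> a ((\<lambda>c. s - c) ` Z) = flip k (a + axis k (real (Suc s) * \<delta>)) ` bar k \<delta> 0 Z"
  unfolding bar_def image_UN image_image
  by (intro SUP_cong refl cell_flip[OF assms, symmetric])

lemma box_nonempty:
  assumes "\<delta> > 0"
  shows "box a (a + vec \<delta> :: 'n::finite space) \<noteq> {}"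
proof -
  have "a + vec (\<delta>/2) \<in> box a (a + vec \<delta>)"
    using assms by (simp add: mem_box_cart)
  then show ?thesis by blast
qed

lemma box_subset_interior_bar:
  assumes "c \<in> Z"
  shows "box (a + axis k (real c * \<delta>)) (a + axis k (real c * \<delta>) + vec \<delta>) \<subseteq> interior (bar k \<delta> a Z)"
proof (rule interior_maximal)
  have "box (a + axis k (real c * \<delta>)) (a + axis k (real c * \<delta>) + vec \<delta>) \<subseteq> cell k \<delta> a c"
    unfolding cell_def by (rule box_subset_cbox)
  then show "box (a + axis k (real c * \<delta>)) (a + axis k (real c * \<delta>) + vec \<delta>) \<subseteq> bar k \<delta> a Z"
    using assms unfolding bar_def by blast
qed (rule open_box)

lemma compact_bar: "finite Z \<Longrightarrow> compact (bar k \<delta> a Z)"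
  unfolding bar_def cell_def by (intro compact_UN) auto

lemma closure_interior_bar:
  assumes "\<delta> > 0" "finite Z"
  shows "closure (interior (bar k \<delta> a Z)) = bar k \<delta> a Z"
proof
  show "closure (interior (bar k \<delta> a Z)) \<subseteq> bar k \<delta> a Z"
    using compact_bar[OF assms(2)] by (intro closure_minimal interior_subset) (rule compact_imp_closed)
  have "cell k \<delta> a c \<subseteq> closure (interior (bar k \<delta> a Z))" if "c \<in> Z" for c
  proof -
    have "cell k \<delta> a c = closure (box (a + axis k (real c * \<delta>)) (a + axis k (real c * \<delta>) + vec \<delta>))"
      unfolding cell_def using box_nonempty[OF assms(1)] by (rule closure_box[symmetric])
    then show ?thesis
      using closure_mono[OF box_subset_interior_bar[OF that]] by simp
  qed
  then show "bar k \<delta> a Z \<subseteq> closure (interior (bar k \<delta> a Z))"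
    unfolding bar_def by blast
qed

lemma interior_bar_meet:
  assumes "\<delta> > 0" "Z \<inter> Z' \<noteq> {}"
  shows "interior (bar k \<delta> a Z) \<inter> interior (bar k \<delta> a Z') \<noteq> {}"
proof -
  obtain c where "c \<in> Z" "c \<in> Z'"
    using assms(2) by blast
  then have "box (a + axis k (real c * \<delta>)) (a + axis k (real c * \<delta>) + vec \<delta>)
      \<subseteq> interior (bar k \<delta> a Z) \<inter> interior (bar k \<delta> a Z')"
    by (intro Int_greatest box_subset_interior_bar)
  then show ?thesis
    using box_nonempty[OF assms(1), of "a + axis k (real c * \<delta>)"] by auto
qed

text \<open>The interior of a union may exceed the union of the interiors, so cells cannot be
  compared one by one. Instead, different cells meet only in a hyperplane, and an open set inside
  finitely many hyperplanes is negligible, hence empty.\<close>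

lemma interior_bar_disjoint:
  fixes a :: "'a::finite space"
  assumes "\<delta> > 0" "finite Z" "finite Z'" "Z \<inter> Z' = {}"
  shows "interior (bar k \<delta> a Z) \<inter> interior (bar k \<delta> a Z') = {}"
proof -
  let ?U = "interior (bar k \<delta> a Z) \<inter> interior (bar k \<delta> a Z')"
  have "?U \<subseteq> (\<Union>c\<in>Z \<union> Z'. {x. x $ k = a $ k + real c * \<delta>})"
  proof
    fix x assume "x \<in> ?U"
    then have "x \<in> bar k \<delta> a Z" "x \<in> bar k \<delta> a Z'"
      using interior_subset by blast+
    then obtain c c' where c: "c \<in> Z" "c' \<in> Z'" "x \<in> cell k \<delta> a c" "x \<in> cell k \<delta> a c'"
      by (auto simp: bar_def)
    have *: "x $ k = a $ k + c' * \<delta>" if c: "x \<in> cell k \<delta> a c" "x \<in> cell k \<delta> a c'" "c < c'" for c c'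
    proof -
      have "a $ k + c' * \<delta> \<le> x $ k" "x $ k \<le> a $ k + c * \<delta> + \<delta>"
        using c(1,2) by (auto simp: mem_cell split: if_splits dest!: spec[of _ k])
      moreover have "(real c + 1) * \<delta> \<le> c' * \<delta>"
        using c(3) assms(1) by (intro mult_right_mono) auto
      ultimately show ?thesis
        by (simp add: algebra_simps)
    qed
    have "c < c' \<or> c' < c"
      using c assms(4) by (metis disjoint_iff nat_neq_iff)
    then show "x \<in> (\<Union>c\<in>Z \<union> Z'. {x. x $ k = a $ k + real c * \<delta>})"
      using * c by blast
  qed
  moreover have "negligible {x :: 'a space. x $ k = t}" for t
    using negligible_standard_hyperplane[of "axis k (1::real)" t] by (simp add: inner_axis)
  then have "negligible (\<Union>c\<in>Z \<union> Z'. {x :: 'a space. x $ k = a $ k + real c * \<delta>})"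
    using assms(2,3) by (intro negligible_Union) blast+
  ultimately have "negligible ?U"
    by (rule negligible_subset[rotated])
  then show ?thesis
    using open_not_negligible[of ?U] by auto
qed

lemma bar_lessThan:
  assumes "\<delta> > 0" "0 < M"
  shows "bar k \<delta> a {..<M} = cbox a (a + axis k ((real M - 1) * \<delta>) + vec \<delta>)"
proof (intro equalityI subsetI)
  fix x assume "x \<in> bar k \<delta> a {..<M}"
  then obtain c where c: "c < M" "x \<in> cell k \<delta> a c"
    by (auto simp: bar_def)
  have "real c * \<delta> \<le> (real M - 1) * \<delta>" "0 \<le> real c * \<delta>"
    using c(1) assms(1) by (auto intro!: mult_right_mono)
  then show "x \<in> cbox a (a + axis k ((real M - 1) * \<delta>) + vec \<delta>)"
    using c(2) unfolding mem_cell mem_box_cart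
    by (auto simp: axis_def split: if_splits dest: spec[of _ k] intro: order_trans)
next
  fix x assume x: "x \<in> cbox a (a + axis k ((real M - 1) * \<delta>) + vec \<delta>)"
  define y where "y = (x $ k - a $ k) / \<delta>"
  have xk: "x $ k = a $ k + y * \<delta>"
    using assms(1) by (simp add: y_def)
  have "a $ k \<le> x $ k" "x $ k \<le> a $ k + (real M - 1) * \<delta> + \<delta>"
    using x by (auto simp: mem_box_cart axis_def dest: spec[of _ k])
  then have "0 \<le> y" "y \<le> M"
    using assms(1) by (auto simp: y_def field_simps)
  \<comment> \<open>The far end \<open>y = M\<close> belongs to the last cell; rounding down would
    give the index \<open>M\<close> outside the row.\<close>
  then obtain c where c: "c < M" "real c \<le> y" "y \<le> real c + 1"
  proof (cases "y = M")
    case True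
    then show ?thesis
      using assms(2) that[of "M - 1"] by (auto simp: of_nat_diff)
  next
    case False
    then show ?thesis
      using \<open>0 \<le> y\<close> \<open>y \<le> M\<close> that[of "nat \<lfloor>y\<rfloor>"] by (auto simp: nat_less_iff floor_less_iff)
  qed
  have "real c * \<delta> \<le> y * \<delta>" "y * \<delta> \<le> real c * \<delta> + \<delta>"
    using c(2,3) assms(1) mult_right_mono[of y "real c + 1" \<delta>] by (auto simp: algebra_simps)
  then have "x \<in> cell k \<delta> a c"
    using x xk unfolding mem_cell mem_box_cart
    by (auto simp: axis_def split: if_splits dest: spec)
  then show "x \<in> bar k \<delta> a {..<M}"
    using c(1) by (auto simp: bar_def)
qed

text \<open>Both versions serve: the open hole is removed from a shape, and the closed row bounds
  the pieces filling it.\<close>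

lemma measure_interior_bar_lessThan:
  fixes a :: "'n::finite space"
  assumes "\<delta> > 0" "0 < M"
  shows "measure lebesgue (interior (bar k \<delta> a {..<M})) = M * \<delta> ^ CARD('n)"
    and "measure lebesgue (bar k \<delta> a {..<M}) = M * \<delta> ^ CARD('n)"
proof -
  let ?b = "a + axis k ((real M - 1) * \<delta>) + vec \<delta>"
  have "a \<in> bar k \<delta> a {..<M}"
    using assms by (auto simp: bar_def mem_cell intro!: bexI[of _ 0])
  then have "cbox a ?b \<noteq> {}"
    using bar_lessThan[OF assms, of k a] by auto
  then have "measure lborel (cbox a ?b) = (\<Prod>i\<in>UNIV. ?b $ i - a $ i)"
    by (rule content_cbox_cart)
  also have "\<dots> = (\<Prod>i\<in>UNIV. (if i = k then real M else 1) * \<delta>)"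
    by (rule prod.cong) (auto simp: axis_def algebra_simps)
  also have "\<dots> = M * \<delta> ^ CARD('n)"
    by (simp add: prod.distrib)
  finally have *: "measure lborel (cbox a ?b) = M * \<delta> ^ CARD('n)" .
  then show "measure lebesgue (bar k \<delta> a {..<M}) = M * \<delta> ^ CARD('n)"
    by (simp add: bar_lessThan[OF assms] measure_lborel_cbox)
  show "measure lebesgue (interior (bar k \<delta> a {..<M})) = M * \<delta> ^ CARD('n)"
    using * by (simp add: bar_lessThan[OF assms] interior_cbox measure_lborel_box_eq measure_lborel_cbox_eq)
qed

text \<open>
  The two tilings of the discrete interval \<open>{..<9}\<close> by the prototile \<open>{0, 1, 5}\<close> and its
  reflection. They are mirror images of each other.
\<close>

definition gadget :: "bool \<Rightarrow> nat set set" where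
  "gadget b = (if b then {{0,4,5}, {1,2,6}, {3,7,8}} else {{0,1,5}, {2,6,7}, {3,4,8}})"

text \<open>A one-hot code: of \<open>M\<close> consecutive blocks of nine cells only block
  \<open>i\<close> is filled in the \<open>True\<close> way. Different numbers are then told apart
  inside a single block.\<close>

definition gadgets :: "nat \<Rightarrow> nat \<Rightarrow> nat set set" where
  "gadgets i M = (\<Union>j<M. (`) ((+) (9 * j)) ` gadget (j = i))"

lemma gadget_Union: "\<Union>(gadget b) = {..<9}"
  by (auto simp: gadget_def)

lemma gadget_disjoint: "Z \<in> gadget b \<Longrightarrow> Z' \<in> gadget b \<Longrightarrow> Z \<noteq> Z' \<Longrightarrow> Z \<inter> Z' = {}"
  by (auto simp: gadget_def split: if_splits)

text \<open>The condition \<open>s \<ge> 5\<close> keeps the subtraction of natural numbers from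
  truncating.\<close>

lemma gadget_shape:
  assumes "Z \<in> gadget b"
  shows "(\<exists>s. Z = (+) s ` {0,1,5}) \<or> (\<exists>s\<ge>5. Z = (\<lambda>c. s - c) ` {0,1,5})"
proof -
  have flips: "{0,4,5} = (\<lambda>c. 5 - c) ` {0,1,5::nat}" "{3,7,8} = (\<lambda>c. 8 - c) ` {0,1,5::nat}"
    "{2,6,7} = (\<lambda>c. 7 - c) ` {0,1,5::nat}"
    and shifts: "{1,2,6} = (+) 1 ` {0,1,5::nat}" "{0,1,5} = (+) 0 ` {0,1,5::nat}"
    "{3,4,8} = (+) 3 ` {0,1,5::nat}"
    by auto
  from assms consider "Z = {0,4,5}" | "Z = {3,7,8}" | "Z = {2,6,7}" | "Z \<in> {{1,2,6}, {0,1,5}, {3,4,8}}"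
    unfolding gadget_def by (auto split: if_splits)
  then show ?thesis
  proof cases
    case 1
    then show ?thesis
      unfolding flips(1) by (intro disjI2 exI[of _ 5]) simp
  next
    case 2
    then show ?thesis
      unfolding flips(2) by (intro disjI2 exI[of _ 8]) simp
  next
    case 3
    then show ?thesis
      unfolding flips(3) by (intro disjI2 exI[of _ 7]) simp
  next
    case 4
    then show ?thesis
      using shifts by (intro disjI1) blast
  qed
qed

lemma finite_gadgets: "finite (gadgets i M)"
  by (simp add: gadgets_def gadget_def)

lemma gadgets_Union: "\<Union>(gadgets i M) = {..<9 * M}"
proof -
  have "\<Union>(gadgets i M) = (\<Union>j<M. (+) (9 * j) ` \<Union>(gadget (j = i)))"
    unfolding gadgets_def by blast
  also have "\<dots> = (\<Union>j<M. {9 * j..<9 * j + 9})"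
    by (simp add: gadget_Union lessThan_atLeast0 add.commute image_add_atLeastLessThan)
  also have "\<dots> = {..<9 * M}"
  proof (intro equalityI subsetI)
    fix x assume "x \<in> {..<9 * M}"
    then have "x div 9 < M" "x \<in> {9 * (x div 9)..<9 * (x div 9) + 9}"
      by auto
    then show "x \<in> (\<Union>j<M. {9 * j..<9 * j + 9})"
      by blast
  qed auto
  finally show ?thesis .
qed

lemma gadgets_finite_nonempty:
  assumes "Z \<in> gadgets i M"
  shows "finite Z" "Z \<noteq> {}"
proof -
  obtain j Y where Z: "Z = (+) (9 * j) ` Y" "Y \<in> gadget (j = i)"
    using assms by (auto simp: gadgets_def)
  have "finite Y" "Y \<noteq> {}"
    using gadget_shape[OF Z(2)] by auto
  then show "finite Z" "Z \<noteq> {}"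
    using Z(1) by auto
qed

lemma gadgets_disjoint:
  assumes "Z \<in> gadgets i M" "Z' \<in> gadgets i M" "Z \<noteq> Z'"
  shows "Z \<inter> Z' = {}"
proof -
  obtain j Y where 1: "Z = (+) (9 * j) ` Y" "Y \<in> gadget (j = i)"
    using assms(1) by (auto simp: gadgets_def)
  obtain j' Y' where 2: "Z' = (+) (9 * j') ` Y'" "Y' \<in> gadget (j' = i)"
    using assms(2) by (auto simp: gadgets_def)
  have Y: "Y \<subseteq> {..<9}" "Y' \<subseteq> {..<9}"
    using gadget_Union 1(2) 2(2) by blast+
  show ?thesis
  proof (cases "j = j'")
    case True
    then have "Y \<noteq> Y'"
      using assms(3) 1 2 by blast
    then show ?thesis
      using gadget_disjoint[of Y "j = i" Y'] 1 2 True by auto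
  next
    case False
    then consider "j < j'" | "j' < j"
      by linarith
    then show ?thesis
      using Y unfolding 1(1) 2(1) by cases fastforce+
  qed
qed

lemma gadgets_shape:
  assumes "Z \<in> gadgets i M"
  shows "(\<exists>s. Z = (+) s ` {0,1,5}) \<or> (\<exists>s\<ge>5. Z = (\<lambda>c. s - c) ` {0,1,5})"
proof -
  obtain j Y where 1: "Z = (+) (9 * j) ` Y" "Y \<in> gadget (j = i)"
    using assms by (auto simp: gadgets_def)
  from gadget_shape[OF 1(2)] show ?thesis
  proof (elim disjE exE conjE)
    fix s assume "Y = (+) s ` {0,1,5}"
    then have "Z = (+) (9 * j + s) ` {0,1,5}"
      unfolding 1(1) by (simp add: image_image add.assoc)
    then show ?thesis by blast
  next
    fix s :: nat assume s: "s \<ge> 5" "Y = (\<lambda>c. s - c) ` {0,1,5}"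
    then have "Z = (\<lambda>c. (9 * j + s) - c) ` {0,1,5}"
      unfolding 1(1) by (simp add: image_image)
    moreover have "9 * j + s \<ge> 5"
      using s(1) by simp
    ultimately show ?thesis by blast
  qed
qed

lemma gadgets_distinguish:
  assumes "i < M" "i \<noteq> i'"
  shows "\<exists>Z\<in>gadgets i M. \<exists>Z'\<in>gadgets i' M. Z \<noteq> Z' \<and> Z \<inter> Z' \<noteq> {}"
proof -
  \<comment> \<open>In block \<open>i\<close> the two fillings differ; these pieces share the cell
    \<open>9 * i\<close>, but only the first has \<open>9 * i + 4\<close>.\<close>
  let ?Z = "(+) (9 * i) ` {0,4,5}" and ?Z' = "(+) (9 * i) ` {0,1,5}"
  have "?Z \<in> gadgets i M" "?Z' \<in> gadgets i' M"
    using assms unfolding gadgets_def by (auto simp: gadget_def)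
  moreover have "9 * i + 4 \<in> ?Z" "9 * i + 4 \<notin> ?Z'"
    by auto
  then have "?Z \<noteq> ?Z'"
    by metis
  moreover have "?Z \<inter> ?Z' \<noteq> {}"
    by auto
  ultimately show ?thesis
    by (intro bexI conjI)
qed

text \<open>Shifts of indices become translations and reversals of indices become
  \<open>flip\<close>, so one prototile serves all pieces of all fillings.\<close>

lemma bar_gadgets_tiles:
  assumes "Z \<in> gadgets i M"
  shows "bar k \<delta> a Z \<in> tiles {bar k \<delta> 0 {0,1,5}} isometry_group"
  using gadgets_shape[OF assms]
proof (elim disjE exE conjE)
  fix s assume "Z = (+) s ` {0,1,5}"
  then have "bar k \<delta> a Z = (+) (a + axis k (real s * \<delta>)) ` id ` bar k \<delta> 0 {0,1,5}"
    by (simp only: bar_shift bar_plus image_id id_apply add_0_right)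
  moreover have "id ` bar k \<delta> 0 {0,1,5} \<in> tiles {bar k \<delta> 0 {0,1,5}} isometry_group"
    unfolding tiles_def by (intro CollectI exI[of _ id]) (auto simp: isometry_group_def)
  ultimately show ?thesis
    by (simp only: tiles_translate)
next
  fix s :: nat assume s: "s \<ge> 5" "Z = (\<lambda>c. s - c) ` {0,1,5}"
  have "bar k \<delta> a Z = flip k (a + axis k (real (Suc s) * \<delta>)) ` bar k \<delta> 0 {0,1,5}"
    unfolding s(2) using s(1) by (intro bar_flip) auto
  then show ?thesis
    unfolding tiles_def using flip_isometry by blast
qed

section \<open>Perforated tiles\<close>

text \<open>The lower corner of the bounding box, a base point that moves along with a nonempty
  bounded set even if it does not belong to the set.\<close>

definition anchor :: "'n::finite space set \<Rightarrow> 'n space" where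
  "anchor S = (\<chi> i. INF x\<in>S. x $ i)"

lemma anchor_plus:
  assumes "bounded S" "S \<noteq> {}"
  shows "anchor ((+) v ` S) = v + anchor S"
proof -
  have "(INF x\<in>S. v $ i + x $ i) = v $ i + (INF x\<in>S. x $ i)" for i
  proof (rule Inf_add_eq)
    obtain d where "\<And>x. x \<in> S \<Longrightarrow> norm x \<le> d"
      using assms(1) by (auto simp: bounded_iff)
    then have "- d \<le> x $ i" if "x \<in> S" for x
      using that component_le_norm_cart[of x i] by fastforce
    then show "bdd_below ((\<lambda>x. x $ i) ` S)"
      by (intro bdd_belowI2)
  qed (rule assms(2))
  then show ?thesis
    by (simp add: anchor_def vec_eq_iff image_image)
qed

lemma image_plus_eq_imp_eq:
  fixes S :: "'n::finite space set"
  assumes "bounded S" "S \<noteq> {}" "(+) v ` S = (+) w ` S"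
  shows "v = w"
proof -
  have "v + anchor S = w + anchor S"
    unfolding anchor_plus[OF assms(1,2), symmetric] assms(3) ..
  then show ?thesis by simp
qed

text \<open>This makes perforated shapes legitimate prototiles. Points of \<open>S\<close> off
  \<open>H\<close> are approached through \<open>interior S\<close>; boundary points of
  \<open>H\<close> lie in \<open>interior S\<close> by assumption and are approached from outside
  \<open>H\<close>.\<close>

lemma regular_closed_Diff_interior:
  assumes S: "closure (interior S) = S" and "closed H" and H: "H \<subseteq> interior S"
  shows "closure (interior (S - interior H)) = S - interior H"
proof
  have "closed (S - interior H)"
    using S by (metis closed_closure closed_Diff open_interior)
  then show "closure (interior (S - interior H)) \<subseteq> S - interior H"
    by (intro closure_minimal interior_subset)
next
  have open_H: "open (- H)"
    using assms(2) by (rule open_Compl)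
  have "interior S \<inter> - H \<subseteq> interior (S - interior H)"
  proof (rule interior_maximal)
    show "interior S \<inter> - H \<subseteq> S - interior H"
      using interior_subset[of S] interior_subset[of H] by blast
  qed (intro open_Int open_interior open_H)
  then have sub: "closure (interior S \<inter> - H) \<subseteq> closure (interior (S - interior H))"
    by (rule closure_mono)
  show "S - interior H \<subseteq> closure (interior (S - interior H))"
  proof
    fix x assume x: "x \<in> S - interior H"
    have "x \<in> closure (interior S \<inter> - H)"
    proof (cases "x \<in> H")
      case True
      then have "x \<in> interior S"
        using H by blast
      moreover have "x \<in> closure (- H)"
        using x by (simp add: closure_interior)
      ultimately show ?thesis
        using open_Int_closure_subset[OF open_interior, of S "- H"] by blast
    next
      case False
      then have "x \<in> - H \<inter> closure (interior S)"
        using x S by simp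
      then show ?thesis
        using open_Int_closure_subset[OF open_H, of "interior S"] by (auto simp: Int_commute)
    qed
    then show "x \<in> closure (interior (S - interior H))"
      using sub by blast
  qed
qed

lemma bar_subset_iff:
  assumes "\<delta> > 0" "finite Z" "finite Z'" "bar k \<delta> a Z \<subseteq> bar k \<delta> a Z'"
  shows "Z \<subseteq> Z'"
proof
  fix c assume c: "c \<in> Z"
  show "c \<in> Z'"
  proof (rule ccontr)
    assume "c \<notin> Z'"
    then have "interior (bar k \<delta> a {c}) \<inter> interior (bar k \<delta> a Z') = {}"
      using assms by (intro interior_bar_disjoint) auto
    moreover have "bar k \<delta> a {c} \<subseteq> bar k \<delta> a Z'"
      using c assms(4) by (auto simp: bar_def)
    then have "interior (bar k \<delta> a {c}) \<subseteq> interior (bar k \<delta> a Z')"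
      by (rule interior_mono)
    moreover have "interior (bar k \<delta> a {c}) \<noteq> {}"
      using interior_bar_meet[OF assms(1), of "{c}" "{c}" k a] by auto
    ultimately show False by blast
  qed
qed

lemma bar_eq_iff:
  assumes "\<delta> > 0" "finite Z" "finite Z'"
  shows "bar k \<delta> a Z = bar k \<delta> a Z' \<longleftrightarrow> Z = Z'"
  using bar_subset_iff[OF assms] bar_subset_iff[OF assms(1,3,2)] by blast

section \<open>Conditions on the side length of the cubes\<close>

text \<open>Stated with a filter, as are the next two lemmas, so that finitely many smallness
  conditions on \<open>\<delta>\<close> can be met at once.\<close>

lemma eventually_bar_subset:
  fixes a :: "'n::finite space"
  assumes "open U" "a \<in> U"
  shows "\<forall>\<^sub>F \<delta> in at_right 0. bar k \<delta> a {..<M} \<subseteq> U"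
proof -
  obtain e where e: "e > 0" "ball a e \<subseteq> U"
    using assms open_contains_ball by blast
  \<comment> \<open>Each coordinate of \<open>x - a\<close> is at most
    \<open>Suc M * \<delta>\<close> in absolute value, and the sum of these bounds the norm.
    \<open>Suc\<close> keeps the denominator positive for \<open>M = 0\<close>.\<close>
  let ?b = "e / (CARD('n) * Suc M)"
  have "bar k \<delta> a {..<M} \<subseteq> U" if \<delta>: "\<delta> > 0" "\<delta> < ?b" for \<delta>
  proof
    fix x assume "x \<in> bar k \<delta> a {..<M}"
    then obtain c where c: "c < M" "x \<in> cell k \<delta> a c"
      by (auto simp: bar_def)
    have "real c * \<delta> + \<delta> \<le> M * \<delta>"
      using mult_right_mono[of "real c + 1" M \<delta>] c(1) \<delta>(1) by (simp add: algebra_simps)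
    then have M: "real c * \<delta> + \<delta> \<le> Suc M * \<delta>" "0 \<le> real c * \<delta>" "\<delta> \<le> Suc M * \<delta>"
      using \<delta>(1) c(1) by (auto simp: distrib_right)
    have "\<bar>(x - a) $ i\<bar> \<le> Suc M * \<delta>" for i
    proof -
      define e where "e = (if i = k then real c * \<delta> else 0)"
      have "a $ i + e \<le> x $ i" "x $ i \<le> a $ i + e + \<delta>"
        using c(2) unfolding mem_cell e_def by blast+
      moreover have "0 \<le> e" "e + \<delta> \<le> Suc M * \<delta>"
        using M by (simp_all only: e_def split: if_split) simp_all
      ultimately show ?thesis
        unfolding vector_minus_component using \<delta>(1) by linarith
    qed
    then have "(\<Sum>i\<in>UNIV. \<bar>(x - a) $ i\<bar>) \<le> (\<Sum>i\<in>(UNIV::'n set). Suc M * \<delta>)"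
      by (intro sum_mono)
    then have "norm (x - a) \<le> CARD('n) * (Suc M * \<delta>)"
      using norm_le_l1_cart[of "x - a"] by simp
    also have "\<dots> = \<delta> * real (CARD('n) * Suc M)"
      by (simp only: of_nat_mult mult_ac)
    also have "\<dots> < e"
      using \<delta>(2) by (simp only: pos_less_divide_eq of_nat_0_less_iff zero_less_card_finite
          nat_0_less_mult_iff zero_less_Suc)
    finally have "x \<in> ball a e"
      by (simp add: dist_norm norm_minus_commute)
    then show "x \<in> U"
      using e(2) by blast
  qed
  moreover have "?b > 0"
    using e(1) by (intro divide_pos_pos)
      (simp_all only: of_nat_0_less_iff zero_less_card_finite nat_0_less_mult_iff zero_less_Suc)
  ultimately show ?thesis
    unfolding eventually_at_right_field by blast
qed

text \<open>If \<open>s = s'\<close>, then \<open>m \<noteq> m'\<close> separates the values for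
  every positive \<open>\<delta>\<close>; otherwise the limits at 0 already differ.\<close>

lemma eventually_separated:
  fixes s s' :: real and m m' n :: nat
  assumes "m \<noteq> m'" "n > 0"
  shows "\<forall>\<^sub>F \<delta> in at_right 0. s - real m * \<delta> ^ n \<noteq> s' - real m' * \<delta> ^ n"
proof (cases "s = s'")
  case True
  have "\<forall>\<^sub>F \<delta> in at_right (0::real). \<delta> > 0"
    by (rule eventually_at_right_less)
  then show ?thesis
    by (rule eventually_mono) (use True assms in auto)
next
  case False
  have "((\<lambda>\<delta>. (s - real m * \<delta> ^ n) - (s' - real m' * \<delta> ^ n)) \<longlongrightarrow> (s - real m * 0 ^ n) - (s' - real m' * 0 ^ n)) (at_right 0)"
    by (intro tendsto_intros)
  then have "\<forall>\<^sub>F \<delta> in at_right 0. (s - real m * \<delta> ^ n) - (s' - real m' * \<delta> ^ n) \<noteq> 0"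
    by (rule tendsto_imp_eventually_ne) (use False assms in \<open>simp add: power_0_left\<close>)
  then show ?thesis
    by (rule eventually_mono) simp
qed

lemma eventually_power_less:
  fixes s :: real and m n :: nat
  assumes "s > 0" "n > 0"
  shows "\<forall>\<^sub>F \<delta> in at_right 0. real m * \<delta> ^ n < s"
proof -
  have "((\<lambda>\<delta>. real m * \<delta> ^ n) \<longlongrightarrow> real m * 0 ^ n) (at_right (0::real))"
    by (intro tendsto_intros)
  then show ?thesis
    by (rule order_tendstoD(2)) (use assms in \<open>simp add: power_0_left\<close>)
qed

section \<open>Cutting tiles in normal position\<close>

text \<open>Placing every anchor at the origin selects one representative of each translation class:
  members of \<open>N\<close> whose shapes are translates of each other have equal shapes.\<close>

locale normalised_tiling =
  fixes N :: "('n::finite, 'c) ctile set" and T :: "('n, 'c) ctile set"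
  assumes finite_N: "finite N"
    and compact_N: "c \<in> N \<Longrightarrow> compact (fst c)"
    and regular_N: "c \<in> N \<Longrightarrow> closure (interior (fst c)) = fst c"
    and nonempty_N: "c \<in> N \<Longrightarrow> fst c \<noteq> {}"
    and anchor_N: "c \<in> N \<Longrightarrow> anchor (fst c) = 0"
    and T_types: "t \<in> T \<Longrightarrow> \<exists>v. \<exists>c\<in>N. t = translate_ctile v c"
    and T_disjoint: "t \<in> T \<Longrightarrow> t' \<in> T \<Longrightarrow> t \<noteq> t' \<Longrightarrow> interior (fst t) \<inter> interior (fst t') = {}"
    and T_cover: "\<Union>(fst ` T) = UNIV"
    and T_flc: "finite_local_complexity T"
begin

lemma interior_N: "c \<in> N \<Longrightarrow> interior (fst c) \<noteq> {}"
  using regular_N nonempty_N by fastforce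

lemma shape_canonical:
  assumes "c \<in> N" "c' \<in> N" "(+) v ` fst c = (+) w ` fst c'"
  shows "v = w \<and> fst c = fst c'"
proof -
  have "anchor ((+) u ` fst d) = u" if "d \<in> N" for u d
    using that anchor_plus[of "fst d" u] by (simp add: compact_N compact_imp_bounded nonempty_N anchor_N)
  then have "v = w"
    using assms by metis
  then show ?thesis
    using assms(3) by (simp add: inj_image_plus)
qed

lemma N_canonical:
  assumes "c \<in> N" "c' \<in> N" "translate_ctile v c = translate_ctile w c'"
  shows "c = c' \<and> v = w"
proof -
  have "(+) v ` fst c = (+) w ` fst c'"
    using assms(3) by (metis fst_translate_ctile)
  then have "v = w"
    using shape_canonical assms(1,2) by blast
  then show ?thesis
    using assms(3) by simp
qed

text \<open>With one colouring per shape nothing has to be cut, and the requirement to tell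
  colourings apart is vacuous.\<close>

lemma subdivided_shapes:
  assumes "inj_on fst N"
  shows "subdivided_tiling N (\<lambda>c. {fst c}) (fst ` N) fst T"
proof
  show "prototile_set (fst ` N)"
    using finite_N compact_N regular_N by (auto simp: prototile_set_def)
  show "{fst c} \<subseteq> tiles (fst ` N) isometry_group" if "c \<in> N" for c
  proof -
    have "id ` fst c \<in> tiles (fst ` N) isometry_group"
      unfolding tiles_def using that by (intro CollectI exI[of _ id]) (auto simp: isometry_group_def)
    then show ?thesis by simp
  qed
  show "v = w \<and> fst c = fst c'"
    if "c \<in> N" "c' \<in> N" "q \<in> {fst c'}" "(+) v ` fst c = (+) w ` q" for c c' q v w
    using shape_canonical[OF that(1,2)] that(3,4) by simp
  show "\<exists>q\<in>{fst c}. \<exists>q'\<in>{fst c'}. q \<noteq> q' \<and> interior q \<inter> interior q' \<noteq> {}"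
    if "c \<in> N" "c' \<in> N" "c \<noteq> c'" "fst c = fst c'" for c c'
    using inj_onD[OF assms that(4,1,2)] that(3) by contradiction
  show "{} \<notin> {fst c}" if "c \<in> N" for c
    using nonempty_N[OF that] by simp
qed (fact finite_N N_canonical interior_N T_types T_disjoint T_cover T_flc | simp add: pairwise_def)+

text \<open>It takes the shape and not the coloured tile, so all colourings of a shape share one
  prototile. Only the interior of the row is removed, which keeps the body closed.\<close>

definition body :: "'n \<Rightarrow> real \<Rightarrow> ('n space set \<Rightarrow> 'n space) \<Rightarrow> ('n space set \<Rightarrow> nat) \<Rightarrow>
    'n space set \<Rightarrow> 'n space set" where
  "body k \<delta> a m S = S - interior (bar k \<delta> (a S) {..<9 * m S})"

definition pieces :: "'n \<Rightarrow> real \<Rightarrow> ('n space set \<Rightarrow> 'n space) \<Rightarrow> ('n space set \<Rightarrow> nat) \<Rightarrow>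
    (('n, 'c) ctile \<Rightarrow> nat) \<Rightarrow> ('n, 'c) ctile \<Rightarrow> 'n space set set" where
  "pieces k \<delta> a m i c =
     insert (body k \<delta> a m (fst c)) (bar k \<delta> (a (fst c)) ` gadgets (i c) (m (fst c)))"

text \<open>
  The numbers of gadgets of different shapes differ, so that a small \<open>\<delta>\<close> separates the volumes of
  the bodies even of shapes with equal volume.
\<close>

lemma ex_gadget_size:
  fixes k :: 'n
  assumes m: "inj_on m (fst ` N)" and pos: "\<And>S. S \<in> fst ` N \<Longrightarrow> 0 < m S"
    and a: "\<And>S. S \<in> fst ` N \<Longrightarrow> a S \<in> interior S"
  obtains \<delta> where "\<delta> > 0"
    "\<And>S. S \<in> fst ` N \<Longrightarrow> bar k \<delta> (a S) {..<9 * m S} \<subseteq> interior S"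
    "\<And>S S'. S \<in> fst ` N \<Longrightarrow> S' \<in> fst ` N \<Longrightarrow>
       measure lebesgue (bar k \<delta> (a S') {..<9 * m S'}) < measure lebesgue (body k \<delta> a m S)"
    "\<And>S S'. S \<in> fst ` N \<Longrightarrow> S' \<in> fst ` N \<Longrightarrow>
       measure lebesgue (body k \<delta> a m S) = measure lebesgue (body k \<delta> a m S') \<Longrightarrow> S = S'"
proof -
  let ?F = "at_right (0::real)" and ?n = "CARD('n)" and ?\<mu> = "measure lebesgue"
  have pos_measure: "0 < ?\<mu> S" if "S \<in> fst ` N" for S
  proof -
    have "S \<in> lmeasurable"
      using that compact_N lmeasurable_compact by blast
    moreover have "\<not> negligible S"
      using that interior_N open_not_negligible[OF open_interior] interior_subset negligible_subset by blast
    ultimately show ?thesis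
      using negligible_iff_measure zero_less_measure_iff by (metis measure_nonneg order_less_le)
  qed
  have "\<forall>\<^sub>F \<delta> in ?F. \<forall>S\<in>fst ` N. bar k \<delta> (a S) {..<9 * m S} \<subseteq> interior S"
    using finite_N a by (intro eventually_ball_finite ballI eventually_bar_subset) auto
  \<comment> \<open>The first summand pays for the hole cut out of \<open>S\<close>, the second is
    the volume of the hole of \<open>S'\<close>, which has to stay below what remains of
    \<open>S\<close>.\<close>
  moreover have "\<forall>\<^sub>F \<delta> in ?F. \<forall>S\<in>fst ` N. \<forall>S'\<in>fst ` N. real (9 * m S + 9 * m S') * \<delta> ^ ?n < ?\<mu> S"
  proof (intro eventually_ball_finite ballI)
    fix S S' assume "S \<in> fst ` N"
    then show "\<forall>\<^sub>F \<delta> in ?F. real (9 * m S + 9 * m S') * \<delta> ^ ?n < ?\<mu> S"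
      by (intro eventually_power_less pos_measure) (simp_all add: card_gt_0_iff)
  qed (use finite_N in simp_all)
  moreover have "\<forall>\<^sub>F \<delta> in ?F. \<forall>S\<in>fst ` N. \<forall>S'\<in>fst ` N. S \<noteq> S' \<longrightarrow>
      ?\<mu> S - real (9 * m S) * \<delta> ^ ?n \<noteq> ?\<mu> S' - real (9 * m S') * \<delta> ^ ?n"
    using finite_N
  proof (intro eventually_ball_finite ballI)
    fix S S' assume "S \<in> fst ` N" "S' \<in> fst ` N"
    then show "\<forall>\<^sub>F \<delta> in ?F. S \<noteq> S' \<longrightarrow>
      ?\<mu> S - real (9 * m S) * \<delta> ^ ?n \<noteq> ?\<mu> S' - real (9 * m S') * \<delta> ^ ?n"
    proof (cases "S = S'")
      case False
      then have "9 * m S \<noteq> 9 * m S'"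
        using m \<open>S \<in> fst ` N\<close> \<open>S' \<in> fst ` N\<close> by (auto dest: inj_onD)
      then have "\<forall>\<^sub>F \<delta> in ?F. ?\<mu> S - real (9 * m S) * \<delta> ^ ?n \<noteq> ?\<mu> S' - real (9 * m S') * \<delta> ^ ?n"
        by (rule eventually_separated) (simp add: card_gt_0_iff)
      then show ?thesis
        by (rule eventually_mono) simp
    qed simp
  qed auto
  ultimately have "\<forall>\<^sub>F \<delta> in ?F. \<delta> > 0 \<and> (\<forall>S\<in>fst ` N. bar k \<delta> (a S) {..<9 * m S} \<subseteq> interior S) \<and>
      (\<forall>S\<in>fst ` N. \<forall>S'\<in>fst ` N. real (9 * m S + 9 * m S') * \<delta> ^ ?n < ?\<mu> S) \<and>
      (\<forall>S\<in>fst ` N. \<forall>S'\<in>fst ` N. S \<noteq> S' \<longrightarrow>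
        ?\<mu> S - real (9 * m S) * \<delta> ^ ?n \<noteq> ?\<mu> S' - real (9 * m S') * \<delta> ^ ?n)"
    by (intro eventually_conj eventually_at_right_less)
  from eventually_happens'[OF trivial_limit_at_right_real this]
  obtain \<delta> where \<delta>: "\<delta> > 0"
      and *: "\<forall>S\<in>fst ` N. bar k \<delta> (a S) {..<9 * m S} \<subseteq> interior S"
        "\<forall>S\<in>fst ` N. \<forall>S'\<in>fst ` N. real (9 * m S + 9 * m S') * \<delta> ^ ?n < ?\<mu> S"
        "\<forall>S\<in>fst ` N. \<forall>S'\<in>fst ` N. S \<noteq> S' \<longrightarrow>
          ?\<mu> S - real (9 * m S) * \<delta> ^ ?n \<noteq> ?\<mu> S' - real (9 * m S') * \<delta> ^ ?n"
    by (elim exE conjE) (rule that)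
  note sub = *(1)[rule_format] and less = *(2)[rule_format] and sep = *(3)[rule_format]
  have body: "?\<mu> (body k \<delta> a m S) = ?\<mu> S - real (9 * m S) * \<delta> ^ ?n" if "S \<in> fst ` N" for S
  proof -
    have "S \<in> lmeasurable"
      using that compact_N lmeasurable_compact by blast
    moreover have "interior (bar k \<delta> (a S) {..<9 * m S}) \<subseteq> S"
      using sub[OF that] interior_subset by blast
    ultimately have "?\<mu> (body k \<delta> a m S) = ?\<mu> S - ?\<mu> (interior (bar k \<delta> (a S) {..<9 * m S}))"
      unfolding body_def by (intro measurable_measure_Diff) auto
    then show ?thesis
      using measure_interior_bar_lessThan(1)[OF \<delta>, of "9 * m S" k "a S"] pos[OF that] by simp
  qed
  have bar: "?\<mu> (bar k \<delta> (a S) {..<9 * m S}) = real (9 * m S) * \<delta> ^ ?n" if "S \<in> fst ` N" for S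
    using measure_interior_bar_lessThan(2)[OF \<delta>, of "9 * m S" k "a S"] pos[OF that] by simp
  show ?thesis
  proof (rule that[OF \<delta> sub])
    show "?\<mu> (bar k \<delta> (a S') {..<9 * m S'}) < ?\<mu> (body k \<delta> a m S)"
      if "S \<in> fst ` N" "S' \<in> fst ` N" for S S'
      using less[OF that] unfolding body[OF that(1)] bar[OF that(2)] of_nat_add distrib_right by linarith
    show "S = S'" if "S \<in> fst ` N" "S' \<in> fst ` N" "?\<mu> (body k \<delta> a m S) = ?\<mu> (body k \<delta> a m S')" for S S'
      using sep[OF that(1,2)] that by (auto simp: body)
  qed
qed

text \<open>The prototiles are one body for each shape and the common filler.\<close>

lemma subdivided_gadgets:
  "\<exists>D X b. subdivided_tiling N D X b T \<and> card X \<le> Suc (card (fst ` N))"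
proof -
  obtain i where i: "inj_on i N" "\<And>c. c \<in> N \<Longrightarrow> i c < card N"
  proof -
    obtain h where h: "bij_betw h N {0..<card N}"
      using ex_bij_betw_finite_nat[OF finite_N] by blast
    show ?thesis
    proof (rule that)
      show "inj_on h N"
        using h by (rule bij_betw_imp_inj_on)
      show "h c < card N" if "c \<in> N" for c
        using bij_betwE[OF h] that by auto
    qed
  qed
  obtain j :: "'n space set \<Rightarrow> nat" where j: "inj_on j (fst ` N)"
    using finite_imp_inj_to_nat_seg[of "fst ` N"] finite_N by auto
  \<comment> \<open>The summand \<open>card N\<close> leaves room for the code of every coloured
    tile, and \<open>j S\<close> makes the numbers of gadgets differ from shape to shape.\<close>
  define m where "m S = card N + j S" for S
  have m: "i c < m (fst c)" if "c \<in> N" for c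
    using i(2)[OF that] by (simp add: m_def)
  have pos: "0 < m S" if "S \<in> fst ` N" for S
    using that finite_N by (auto simp: m_def card_gt_0_iff)
  have "\<forall>S\<in>fst ` N. \<exists>x. x \<in> interior S"
    using interior_N by blast
  from bchoice[OF this] obtain a where a: "\<And>S. S \<in> fst ` N \<Longrightarrow> a S \<in> interior S"
    by blast
  \<comment> \<open>Any coordinate direction will do for the rows.\<close>
  obtain k :: 'n where True by blast
  have inj_m: "inj_on m (fst ` N)"
    using j by (simp add: m_def inj_on_def)
  obtain \<delta> where \<delta>: "\<delta> > 0"
    and hole: "\<And>S. S \<in> fst ` N \<Longrightarrow> bar k \<delta> (a S) {..<9 * m S} \<subseteq> interior S"
    and small: "\<And>S S'. S \<in> fst ` N \<Longrightarrow> S' \<in> fst ` N \<Longrightarrow>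
       measure lebesgue (bar k \<delta> (a S') {..<9 * m S'}) < measure lebesgue (body k \<delta> a m S)"
    and sep: "\<And>S S'. S \<in> fst ` N \<Longrightarrow> S' \<in> fst ` N \<Longrightarrow>
       measure lebesgue (body k \<delta> a m S) = measure lebesgue (body k \<delta> a m S') \<Longrightarrow> S = S'"
    using ex_gadget_size[OF inj_m pos a] by blast
  let ?B = "body k \<delta> a m" and ?h = "bar k \<delta> 0 {0,1,5}" and ?D = "pieces k \<delta> a m i"
  let ?X = "insert ?h (?B ` fst ` N)"
  have compact_B: "compact (?B S)" if "S \<in> fst ` N" for S
    unfolding body_def using that compact_N by (intro compact_diff) auto
  have nonempty_B: "?B S \<noteq> {}" if "S \<in> fst ` N" for S
    using small[OF that that] by (metis measure_empty measure_nonneg not_less)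
  have sub_hole: "bar k \<delta> b Z \<subseteq> bar k \<delta> b {..<9 * M}" if "Z \<in> gadgets q M" for b Z q M
    using that gadgets_Union[of q M] unfolding bar_def by blast
  have prototile: "prototile_set ?X"
    unfolding prototile_set_def
  proof (intro conjI ballI)
    show "finite ?X"
      using finite_N by simp
    fix P assume P: "P \<in> ?X"
    then show "compact P"
      using compact_B by (auto intro: compact_bar)
    show "closure (interior P) = P"
    proof (cases "P = ?h")
      case True
      then show ?thesis
        by (simp only: closure_interior_bar[OF \<delta>] finite.intros)
    next
      case False
      then obtain S where S: "S \<in> fst ` N" "P = ?B S"
        using P by blast
      have "closure (interior S) = S"
        using S(1) regular_N by blast
      moreover have "closed (bar k \<delta> (a S) {..<9 * m S})"
        by (intro compact_imp_closed compact_bar finite_lessThan)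
      ultimately show ?thesis
        unfolding S(2) body_def using hole[OF S(1)] by (rule regular_closed_Diff_interior)
    qed
  qed
  have "subdivided_tiling N ?D ?X (\<lambda>c. ?B (fst c)) T"
  proof
    fix c assume c: "c \<in> N"
    then have S: "fst c \<in> fst ` N" by blast
    show "finite (?D c)"
      by (simp add: pieces_def finite_gadgets)
    have "\<Union>(bar k \<delta> (a (fst c)) ` gadgets (i c) (m (fst c))) = bar k \<delta> (a (fst c)) {..<9 * m (fst c)}"
      unfolding gadgets_Union[of "i c", symmetric] bar_def by blast
    then show "\<Union>(?D c) = fst c"
      unfolding pieces_def body_def using hole[OF S] interior_subset[of "fst c"]
        interior_subset[of "bar k \<delta> (a (fst c)) {..<9 * m (fst c)}"] by auto
    show "pairwise (\<lambda>s t. interior s \<inter> interior t = {}) (?D c)"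
      unfolding pieces_def pairwise_insert
    proof (intro conjI allI impI)
      show "pairwise (\<lambda>s t. interior s \<inter> interior t = {}) (bar k \<delta> (a (fst c)) ` gadgets (i c) (m (fst c)))"
      proof (rule pairwiseI)
        fix s t assume st: "s \<in> bar k \<delta> (a (fst c)) ` gadgets (i c) (m (fst c))"
          "t \<in> bar k \<delta> (a (fst c)) ` gadgets (i c) (m (fst c))" "s \<noteq> t"
        then obtain Z Z' where Z: "Z \<in> gadgets (i c) (m (fst c))" "Z' \<in> gadgets (i c) (m (fst c))"
          "s = bar k \<delta> (a (fst c)) Z" "t = bar k \<delta> (a (fst c)) Z'"
          by blast
        then have "Z \<inter> Z' = {}"
          using st(3) gadgets_disjoint by blast
        then show "interior s \<inter> interior t = {}"
          unfolding Z using Z gadgets_finite_nonempty \<delta> by (intro interior_bar_disjoint) auto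
      qed
      fix s assume "s \<in> bar k \<delta> (a (fst c)) ` gadgets (i c) (m (fst c)) \<and> s \<noteq> ?B (fst c)"
      then have "s \<subseteq> bar k \<delta> (a (fst c)) {..<9 * m (fst c)}"
        using sub_hole by blast
      then have "interior s \<subseteq> interior (bar k \<delta> (a (fst c)) {..<9 * m (fst c)})"
        by (rule interior_mono)
      then show "interior (?B (fst c)) \<inter> interior s = {}" "interior s \<inter> interior (?B (fst c)) = {}"
        using interior_subset[of "?B (fst c)"] unfolding body_def by blast+
    qed
    show "?D c \<subseteq> tiles ?X isometry_group"
    proof
      fix s assume s: "s \<in> ?D c"
      show "s \<in> tiles ?X isometry_group"
      proof (cases "s = ?B (fst c)")
        case True
        have "id ` ?B (fst c) \<in> tiles ?X isometry_group"
          unfolding tiles_def using S by (intro CollectI exI[of _ id] exI[of _ "?B (fst c)"])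
            (auto simp: isometry_group_def)
        then show ?thesis
          using True by simp
      next
        case False
        then have "s \<in> tiles {?h} isometry_group"
          using s bar_gadgets_tiles unfolding pieces_def by blast
        then show ?thesis
          unfolding tiles_def by blast
      qed
    qed
    have "bar k \<delta> (a (fst c)) Z \<noteq> {}" if "Z \<in> gadgets (i c) (m (fst c))" for Z
      using interior_bar_meet[OF \<delta>, of Z Z k "a (fst c)"] gadgets_finite_nonempty(2)[OF that] by auto
    then show "{} \<notin> ?D c"
      using nonempty_B[OF S] unfolding pieces_def by (metis imageE insertE)
    show "?B (fst c) \<in> ?D c"
      by (simp add: pieces_def)
    fix c' assume c': "c' \<in> N"
    then have S': "fst c' \<in> fst ` N" by blast
    show "v = w \<and> fst c = fst c'" if q: "q \<in> ?D c'" "(+) v ` ?B (fst c) = (+) w ` q" for q v w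
    proof -
      \<comment> \<open>A piece of a filling has at most the volume of its hole and so is too small
        to be a translate of a body. Among bodies the volume determines the shape.\<close>
      have meas: "measure lebesgue (?B (fst c)) = measure lebesgue q"
        using q(2) measure_translation by metis
      have "q = ?B (fst c')"
      proof (rule ccontr)
        assume "q \<noteq> ?B (fst c')"
        then obtain Z where Z: "Z \<in> gadgets (i c') (m (fst c'))" "q = bar k \<delta> (a (fst c')) Z"
          using q(1) unfolding pieces_def by blast
        have "measure lebesgue q \<le> measure lebesgue (bar k \<delta> (a (fst c')) {..<9 * m (fst c')})"
          unfolding Z(2) using sub_hole[OF Z(1)] gadgets_finite_nonempty(1)[OF Z(1)]
          by (intro measure_mono_fmeasurable) (auto intro: lmeasurable_compact compact_bar fmeasurableD)
        then show False
          using small[OF S S'] meas by simp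
      qed
      then have "fst c = fst c'"
        using sep[OF S S'] meas by simp
      moreover have "v = w"
        using q(2) compact_B[OF S] nonempty_B[OF S] image_plus_eq_imp_eq compact_imp_bounded
        unfolding \<open>q = ?B (fst c')\<close> calculation by metis
      ultimately show ?thesis by simp
    qed
    show "\<exists>q\<in>?D c. \<exists>q'\<in>?D c'. q \<noteq> q' \<and> interior q \<inter> interior q' \<noteq> {}"
      if "c \<noteq> c'" "fst c = fst c'"
    proof -
      have "i c \<noteq> i c'"
        using i(1) c c' that(1) by (auto dest: inj_onD)
      from gadgets_distinguish[OF m[OF c] this]
      obtain Z Z' where Z: "Z \<in> gadgets (i c) (m (fst c))" "Z' \<in> gadgets (i c') (m (fst c))"
        "Z \<noteq> Z'" "Z \<inter> Z' \<noteq> {}"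
        by (elim bexE conjE)
      let ?q = "bar k \<delta> (a (fst c)) Z" and ?q' = "bar k \<delta> (a (fst c)) Z'"
      have "?q \<in> ?D c" "?q' \<in> ?D c'"
        using Z(1,2) by (simp_all add: pieces_def that(2))
      moreover have "?q \<noteq> ?q'"
        using Z(3) bar_eq_iff[OF \<delta> gadgets_finite_nonempty(1)[OF Z(1)] gadgets_finite_nonempty(1)[OF Z(2)]]
        by simp
      moreover have "interior ?q \<inter> interior ?q' \<noteq> {}"
        using \<delta> Z(4) by (rule interior_bar_meet)
      ultimately show ?thesis
        by (intro bexI conjI)
    qed
  qed (fact finite_N N_canonical interior_N prototile T_types T_disjoint T_cover T_flc)+
  moreover have "card ?X \<le> Suc (card (fst ` N))"
  proof -
    have "card ?X \<le> Suc (card (?B ` fst ` N))"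
      by (rule card_insert_le_m1) auto
    also have "\<dots> \<le> Suc (card (fst ` N))"
      using finite_N by (simp add: card_image_le)
    finally show ?thesis .
  qed
  ultimately show ?thesis by blast
qed

lemma ex_subdivision: "\<exists>D X b. subdivided_tiling N D X b T \<and> card X \<le> card N"
proof (cases "inj_on fst N")
  case True
  then show ?thesis
    using subdivided_shapes card_image_le[OF finite_N] by blast
next
  case False
  then have "card (fst ` N) < card N"
    using card_image_le[OF finite_N, of fst] eq_card_imp_inj_on[OF finite_N, of fst]
    by (metis order_le_less)
  then show ?thesis
    using subdivided_gadgets by (meson Suc_leI order_trans)
qed

end

section \<open>From coloured tilings to normal position\<close>

lemma coloured_tile_plus: "coloured_tile g ((+) v) P = translate_ctile v (coloured_tile g id P)"
proof -
  have "inv ((+) v) x = x - v" for x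
    by (rule inv_f_eq) auto
  moreover have "x \<in> (+) v ` P \<longleftrightarrow> x - v \<in> P" for x
    by (force simp: image_iff)
  ultimately show ?thesis
    unfolding coloured_tile_def translate_ctile_def by (auto simp: restrict_def fun_eq_iff)
qed

lemma fst_coloured_tile [simp]: "fst (coloured_tile g f P) = f ` P"
  by (simp add: coloured_tile_def)

text \<open>Prototiles that are translates of each other and coloured accordingly receive the same
  normal form, so they count once.\<close>

definition normal_form :: "('n::finite, 'c) ctile \<Rightarrow> ('n, 'c) ctile" where
  "normal_form t = translate_ctile (- anchor (fst t)) t"

lemma fst_normal_form: "fst (normal_form t) = (+) (- anchor (fst t)) ` fst t"
  by (simp add: normal_form_def)

text \<open>The empty set satisfies the conditions on a prototile. An empty tile equals all its
  translates and so has no position to recover; it is discarded.\<close>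

lemma normalised_tiling_normal_forms:
  assumes P: "prototile_set \<P>"
    and T: "coloured_tiling \<P> translation_group g T" and flc: "finite_local_complexity T"
  shows "normalised_tiling ((\<lambda>P. normal_form (coloured_tile g id P)) ` (\<P> - {{}})) {t \<in> T. fst t \<noteq> {}}"
    (is "normalised_tiling ?N ?T")
proof
  show "finite ?N"
    using P by (simp add: prototile_set_def)
  fix c assume "c \<in> ?N"
  then obtain P where c: "P \<in> \<P>" "P \<noteq> {}" "c = normal_form (coloured_tile g id P)"
    by auto
  have reg: "compact P" "closure (interior P) = P"
    using assms(1) c(1) by (auto simp: prototile_set_def)
  have fst: "fst c = (+) (- anchor P) ` P"
    by (simp add: c(3) fst_normal_form)
  show "compact (fst c)"
    unfolding fst using reg(1) by (rule compact_translation)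
  show "closure (interior (fst c)) = fst c"
    unfolding fst interior_translation closure_translation reg(2) ..
  show "fst c \<noteq> {}"
    using c(2) by (simp add: fst)
  show "anchor (fst c) = 0"
    unfolding fst using anchor_plus[OF compact_imp_bounded[OF reg(1)] c(2), of "- anchor P"] by simp
next
  fix t assume t: "t \<in> ?T"
  then obtain f P where fP: "f \<in> translation_group" "P \<in> \<P>" "t = coloured_tile g f P"
    using T unfolding coloured_tiling_def by blast
  then obtain v where v: "f = (+) v"
    by (auto simp: translation_group_def)
  have "P \<noteq> {}"
    using t by (auto simp: fP(3))
  then have "normal_form (coloured_tile g id P) \<in> ?N"
    using fP(2) by blast
  moreover have "t = translate_ctile (v + anchor P) (normal_form (coloured_tile g id P))"
    by (simp add: fP(3) v coloured_tile_plus normal_form_def translate_ctile_add)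
  ultimately show "\<exists>v. \<exists>c\<in>?N. t = translate_ctile v c"
    by blast
next
  fix t t' assume "t \<in> ?T" "t' \<in> ?T" "t \<noteq> t'"
  then have "fst t \<in> fst ` T" "fst t' \<in> fst ` T" "fst t \<noteq> fst t'"
    using T by (auto simp: coloured_tiling_def dest: inj_onD)
  then show "interior (fst t) \<inter> interior (fst t') = {}"
    using T unfolding coloured_tiling_def tiling_def patch_def pairwise_def by blast
next
  have "\<Union>(fst ` T) = UNIV"
    using T by (simp add: coloured_tiling_def tiling_def)
  then show "\<Union>(fst ` ?T) = UNIV"
    by blast
next
  have "patch_at ?T R x = patch_at T R x" for R x
    by (auto simp: patch_at_def)
  then show "finite_local_complexity ?T"
    using flc by (simp add: finite_local_complexity_def)
qed

text \<open>An empty tile meets no ball and so occurs in no \<open>patch_at\<close>.\<close>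

lemma MLD_nonempty_tiles: "MLD {t \<in> T. fst t \<noteq> {}} T' \<longleftrightarrow> MLD T T'"
proof -
  have "patch_at {t \<in> T. fst t \<noteq> {}} R x = patch_at T R x" for R x
    by (auto simp: patch_at_def)
  then show ?thesis
    by (simp add: MLD_def locally_derivable_def)
qed

theorem theorem1:
  fixes \<P> :: "(real ^ 'n::finite) set set"
    and C :: "'c set" and c\<^sub>0 :: 'c
    and g :: "(real ^ 'n) set \<Rightarrow> real ^ 'n \<Rightarrow> 'c"
    and r :: "'c \<Rightarrow> 'c \<Rightarrow> bool"
    and T :: "('n, 'c) ctile set"
  assumes "prototile_set \<P>"
    and "colouring \<P> C g"
    and "facet_rule C c\<^sub>0 r"
    and "facet_rule_tiling \<P> translation_group g r T"
    and flc: "finite_local_complexity T"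
  shows "\<exists>X \<U> T'. prototile_set X \<and> card X \<le> card \<P> \<and> corona_atlas_rule X isometry_group \<U> \<and>
           corona_atlas_tiling X isometry_group \<U> T' \<and> MLD T (uncoloured T')"
proof -
  let ?N = "(\<lambda>P. normal_form (coloured_tile g id P)) ` (\<P> - {{}})" and ?T = "{t \<in> T. fst t \<noteq> {}}"
  have "coloured_tiling \<P> translation_group g T"
    using assms(4) by (simp add: facet_rule_tiling_def)
  then interpret normalised_tiling ?N ?T
    by (rule normalised_tiling_normal_forms[OF assms(1) _ flc])
  obtain D X b where sub: "subdivided_tiling ?N D X b ?T" and card: "card X \<le> card ?N"
    using ex_subdivision by blast
  interpret subdivided_tiling ?N D X b ?T
    by (rule sub)
  obtain U T'' where "corona_atlas_rule X isometry_group U" "corona_atlas_tiling X isometry_group U T''"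
      "MLD T (uncoloured T'')"
    using exists_corona_atlas_tiling unfolding MLD_nonempty_tiles by blast
  moreover have "card ?N \<le> card \<P>"
    using assms(1) by (meson Diff_subset card_image_le card_mono finite_Diff order_trans prototile_set_def)
  ultimately show ?thesis
    using prototile_X card by (meson order_trans)
qed

end
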